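(* In the emission abatement game, let $(\lambda,\mu)\in\mathcal G_l$ with associated random variable $Z$, and write $z_1=\mathbb E[Z]$, $\sigma_z^2=\mathrm{Var}(Z)$. Then $(\lambda,\mu)$ outperforms the mean field NE $(\hat\alpha,\hat m)$ in terms of payoff, i.e. $\mathfrak J(\lambda,\mu)\ge\mathfrak J(\hat\alpha,\hat m)$, if and only if $$Tz_1(a-b\nu_1)-(z_1^2+\sigma_z^2)\Big(b\frac{T^2}{3}+1\Big)\ge0 .$$
   Context: Emission abatement game. Fix $T>0$, constants $a,b\ge0$ and $\varepsilon>0$. $(\Omega,\mathcal F,\mathbb F=(\mathcal F_t)_{t\in[0,T]},\mathbb P)$ is a complete filtered probability space satisfying the usual conditions, $W$ a one-dimensional $\mathbb F$-Brownian motion, $\xi$ a real $\mathcal F_0$-measurable square-integrable random variable independent of $W$, $\nu_1=\mathbb E[\xi]$; $\mathcal F_0$ supports a uniform random variable independent of $(\xi,W)$. $\mathbb F^1$ is the filtration generated by $\xi$ and $W$ (satisfying the usual conditions). $\mathbb H^2(\mathbb G)$ is the set of real $\mathbb G$-progressively measurable processes $\alpha$ with $\mathbb E\int_0^T\alpha_t^2dt<\infty$. "Independent of $\xi$ and $W$" means independent of the pair $(\xi,W)$. For $\alpha\in\mathbb H^2(\mathbb F)$, $X=X^\alpha$ solves $dX_t=\alpha_tdt+dW_t$, $X_0=\xi$, and $$\mathfrak J(\alpha,\mu)=\mathbb E\Big[\int_0^T\big(a\mu_t-\tfrac b2\mu_t^2-\tfrac12\alpha_t^2-\tfrac\varepsilon2(\mu_t-X_t)^2\big)dt\Big].$$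 A correlated flow is a pair $(\lambda,\mu)$ with $\lambda\in\mathbb H^2(\mathbb F)$ and $\mu$ an $\mathcal F_0$-measurable $\mathcal C([0,T];\mathbb R)$-valued random variable independent of $\xi$ and $W$. $\phi:[0,T]\to\mathbb R$ solves $\dot\phi_t+\varepsilon-\phi_t^2=0$, $\phi_T=0$. Mean field NE: a pair $(\hat\alpha,\hat m)\in\mathbb H^2(\mathbb F^1)\times\mathcal C([0,T];\mathbb R)$ with $\mathfrak J(\hat\alpha,\hat m)=\max_{\beta\in\mathbb H^2(\mathbb F^1)}\mathfrak J(\beta,\hat m)$ and $\hat m_t=\mathbb E[X^{\hat\alpha}_t]$ for all $t$. In this game the unique mean field NE is $\hat m_t=\nu_1$ for all $t$, $\hat\alpha_t=\phi_t(\nu_1-X^{NE}_t)$, where $X^{NE}=X^{\hat\alpha}$. Class $\mathcal G_l$: all correlated flows $(\lambda,\mu)$ with $\mu_t=\nu_1+tZ$ and $\lambda_t=\phi_t(\mu_t-X_t)+Z$, $t\in[0,T]$, where $X=X^\lambda$ and $Z$ is a square-integrable $\mathcal F_0$-measurable real random variable independent of $\xi$ and $W$. *)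

theory Defs
  imports "HOL-Probability.Probability"
begin

text \<open>
  Processes are functions of type \<open>real \<Rightarrow> 'a \<Rightarrow> real\<close> (time first); only their values at times
  in \<open>{0..T}\<close> matter. The same convention applies to filtrations \<open>real \<Rightarrow> 'a measure\<close>, of which
  only the \<open>\<sigma>\<close>-algebras are used, and to \<open>\<phi>\<close> and the deterministic flows.
\<close>

section \<open>Stochastic basis\<close>

text \<open>Unlike \<open>prob_space.indep_var\<close>, the two random variables may take values in different types.\<close>

definition indep_rv ::
  "'a measure \<Rightarrow> 'b measure \<Rightarrow> ('a \<Rightarrow> 'b) \<Rightarrow> 'c measure \<Rightarrow> ('a \<Rightarrow> 'c) \<Rightarrow> bool" where
  "indep_rv M M1 Y1 M2 Y2 \<longleftrightarrow>
     Y1 \<in> measurable M M1 \<and> Y2 \<in> measurable M M2 \<and>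
     prob_space.indep_set M {Y1 -` A \<inter> space M | A. A \<in> sets M1}
                            {Y2 -` B \<inter> space M | B. B \<in> sets M2}"

text \<open>
  A continuous process is viewed as a random variable in the product space; on
  \<open>\<C>([0,T];\<real>)\<close> the evaluations generate the Borel \<open>\<sigma>\<close>-algebra of the uniform norm.
\<close>

abbreviation trajectory_space :: "real \<Rightarrow> (real \<Rightarrow> real) measure" where
  "trajectory_space T \<equiv> PiM {0..T} (\<lambda>_. borel)"

definition trajectory :: "real \<Rightarrow> (real \<Rightarrow> 'a \<Rightarrow> real) \<Rightarrow> 'a \<Rightarrow> real \<Rightarrow> real" where
  "trajectory T Y \<omega> = (\<lambda>t\<in>{0..T}. Y t \<omega>)"

definition indep_of_data ::
  "'a measure \<Rightarrow> real \<Rightarrow> (real \<Rightarrow> 'a \<Rightarrow> real) \<Rightarrow> ('a \<Rightarrow> real) \<Rightarrow> 'b measure \<Rightarrow> ('a \<Rightarrow> 'b) \<Rightarrow> bool" where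
  "indep_of_data M T W \<xi> N Y \<longleftrightarrow>
     indep_rv M N Y (borel \<Otimes>\<^sub>M trajectory_space T) (\<lambda>\<omega>. (\<xi> \<omega>, trajectory T W \<omega>))"

definition usual_filtration :: "'a measure \<Rightarrow> real \<Rightarrow> (real \<Rightarrow> 'a measure) \<Rightarrow> bool" where
  "usual_filtration M T F \<longleftrightarrow>
     (\<forall>t\<in>{0..T}. subalgebra M (F t)) \<and>
     (\<forall>s\<in>{0..T}. \<forall>t\<in>{s..T}. sets (F s) \<subseteq> sets (F t)) \<and>
     (\<forall>N\<in>null_sets M. \<forall>A. A \<subseteq> N \<longrightarrow> A \<in> sets (F 0)) \<and>
     (\<forall>t\<in>{0..<T}. sets (F t) = (\<Inter>s\<in>{t<..T}. sets (F s)))"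

definition brownian_motion ::
  "'a measure \<Rightarrow> real \<Rightarrow> (real \<Rightarrow> 'a measure) \<Rightarrow> (real \<Rightarrow> 'a \<Rightarrow> real) \<Rightarrow> bool" where
  "brownian_motion M T F W \<longleftrightarrow>
     (\<forall>t\<in>{0..T}. W t \<in> borel_measurable (F t)) \<and>
     (\<forall>\<omega>\<in>space M. continuous_on {0..T} (\<lambda>t. W t \<omega>)) \<and>
     (AE \<omega> in M. W 0 \<omega> = 0) \<and>
     (\<forall>s\<in>{0..T}. \<forall>t\<in>{s<..T}.
        distributed M lborel (\<lambda>\<omega>. W t \<omega> - W s \<omega>) (normal_density 0 (sqrt (t - s))) \<and>
        prob_space.indep_set M (sets (F s))
          {(\<lambda>\<omega>. W t \<omega> - W s \<omega>) -` A \<inter> space M | A. A \<in> sets borel})"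

definition raw_filtration ::
  "'a measure \<Rightarrow> (real \<Rightarrow> 'a \<Rightarrow> real) \<Rightarrow> ('a \<Rightarrow> real) \<Rightarrow> real \<Rightarrow> 'a measure" where
  "raw_filtration M W \<xi> t = sigma (space M)
     ({\<xi> -` A \<inter> space M | A. A \<in> sets borel} \<union>
      {W s -` A \<inter> space M | s A. s \<in> {0..t} \<and> A \<in> sets borel} \<union>
      null_sets M)"

text \<open>
  \<open>\<F>\<^sup>1\<close>: the right-continuous version of \<open>raw_filtration\<close>, which already contains the null sets
  (the probability space is complete). At the final time there is nothing to regularise.
\<close>

definition generated_filtration ::
  "'a measure \<Rightarrow> real \<Rightarrow> (real \<Rightarrow> 'a \<Rightarrow> real) \<Rightarrow> ('a \<Rightarrow> real) \<Rightarrow> real \<Rightarrow> 'a measure" where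
  "generated_filtration M T W \<xi> t = sigma (space M)
     (if t < T then \<Inter>s\<in>{t<..T}. sets (raw_filtration M W \<xi> s)
      else sets (raw_filtration M W \<xi> T))"

definition progressively_measurable ::
  "real \<Rightarrow> (real \<Rightarrow> 'a measure) \<Rightarrow> (real \<Rightarrow> 'a \<Rightarrow> real) \<Rightarrow> bool" where
  "progressively_measurable T G \<alpha> \<longleftrightarrow>
     (\<forall>t\<in>{0..T}. (\<lambda>(s, \<omega>). \<alpha> s \<omega>) \<in> borel_measurable (restrict_space borel {0..t} \<Otimes>\<^sub>M G t))"

definition H2 ::
  "'a measure \<Rightarrow> real \<Rightarrow> (real \<Rightarrow> 'a measure) \<Rightarrow> (real \<Rightarrow> 'a \<Rightarrow> real) set" where
  "H2 M T G = {\<alpha>. progressively_measurable T G \<alpha> \<and>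
     (\<integral>\<^sup>+\<omega>. (\<integral>\<^sup>+t\<in>{0..T}. ennreal ((\<alpha> t \<omega>)\<^sup>2) \<partial>lborel) \<partial>M) < \<infinity>}"

section \<open>The emission abatement game\<close>

locale emission_game = prob_space M
  for M :: "'a measure" and F :: "real \<Rightarrow> 'a measure" and W :: "real \<Rightarrow> 'a \<Rightarrow> real"
    and \<xi> :: "'a \<Rightarrow> real" and T a b \<epsilon> :: real and \<phi> :: "real \<Rightarrow> real" +
  assumes T_pos: "T > 0"
    and a_nonneg: "a \<ge> 0" and b_nonneg: "b \<ge> 0" and eps_pos: "\<epsilon> > 0"
    and usual: "usual_filtration M T F"
    and brownian: "brownian_motion M T F W"
    and xi_measurable: "\<xi> \<in> borel_measurable (F 0)"
    and xi_square_integrable: "integrable M (\<lambda>\<omega>. (\<xi> \<omega>)\<^sup>2)"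
    and xi_indep: "indep_rv M borel \<xi> (trajectory_space T) (trajectory T W)"
    and uniform: "\<exists>U\<in>borel_measurable (F 0).
        distr M borel U = uniform_measure lborel {0..1::real} \<and> indep_of_data M T W \<xi> borel U"
    and phi_ode: "\<And>t. t \<in> {0..T} \<Longrightarrow>
        \<exists>D. (\<phi> has_real_derivative D) (at t within {0..T}) \<and> D + \<epsilon> - (\<phi> t)\<^sup>2 = 0"
    and phi_terminal: "\<phi> T = 0"

definition state ::
  "(real \<Rightarrow> 'a \<Rightarrow> real) \<Rightarrow> ('a \<Rightarrow> real) \<Rightarrow> (real \<Rightarrow> 'a \<Rightarrow> real) \<Rightarrow> real \<Rightarrow> 'a \<Rightarrow> real" where
  "state W \<xi> \<alpha> t \<omega> = \<xi> \<omega> + (LBINT s:{0..t}. \<alpha> s \<omega>) + W t \<omega>"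

text \<open>
  Bochner integrals: a divergent payoff would be read as \<open>0\<close>, but the integrals converge
  absolutely when \<open>\<alpha>\<close> is in \<open>H2\<close> and \<open>\<mu>\<close> has \<open>\<mu>\<^sup>2\<close> integrable over \<open>[0,T] \<times> \<Omega>\<close>.
\<close>

definition payoff ::
  "'a measure \<Rightarrow> (real \<Rightarrow> 'a \<Rightarrow> real) \<Rightarrow> ('a \<Rightarrow> real) \<Rightarrow> real \<Rightarrow> real \<Rightarrow> real \<Rightarrow> real \<Rightarrow>
   (real \<Rightarrow> 'a \<Rightarrow> real) \<Rightarrow> (real \<Rightarrow> 'a \<Rightarrow> real) \<Rightarrow> real" where
  "payoff M W \<xi> T a b \<epsilon> \<alpha> \<mu> = prob_space.expectation M (\<lambda>\<omega>. LBINT t:{0..T}.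
     a * \<mu> t \<omega> - b / 2 * (\<mu> t \<omega>)\<^sup>2 - 1 / 2 * (\<alpha> t \<omega>)\<^sup>2
       - \<epsilon> / 2 * (\<mu> t \<omega> - state W \<xi> \<alpha> t \<omega>)\<^sup>2)"

definition correlated_flow ::
  "'a measure \<Rightarrow> (real \<Rightarrow> 'a measure) \<Rightarrow> (real \<Rightarrow> 'a \<Rightarrow> real) \<Rightarrow> ('a \<Rightarrow> real) \<Rightarrow> real \<Rightarrow>
   (real \<Rightarrow> 'a \<Rightarrow> real) \<Rightarrow> (real \<Rightarrow> 'a \<Rightarrow> real) \<Rightarrow> bool" where
  "correlated_flow M F W \<xi> T \<Lambda> \<mu> \<longleftrightarrow>
     \<Lambda> \<in> H2 M T F \<and>
     (\<forall>\<omega>\<in>space M. continuous_on {0..T} (\<lambda>t. \<mu> t \<omega>)) \<and>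
     trajectory T \<mu> \<in> measurable (F 0) (trajectory_space T) \<and>
     indep_of_data M T W \<xi> (trajectory_space T) (trajectory T \<mu>)"

definition mean_field_NE ::
  "'a measure \<Rightarrow> (real \<Rightarrow> 'a \<Rightarrow> real) \<Rightarrow> ('a \<Rightarrow> real) \<Rightarrow> real \<Rightarrow> real \<Rightarrow> real \<Rightarrow> real \<Rightarrow>
   (real \<Rightarrow> 'a \<Rightarrow> real) \<Rightarrow> (real \<Rightarrow> real) \<Rightarrow> bool" where
  "mean_field_NE M W \<xi> T a b \<epsilon> \<alpha> m \<longleftrightarrow>
     \<alpha> \<in> H2 M T (generated_filtration M T W \<xi>) \<and>
     continuous_on {0..T} m \<and>
     (\<forall>\<beta>\<in>H2 M T (generated_filtration M T W \<xi>).
        payoff M W \<xi> T a b \<epsilon> \<beta> (\<lambda>t _. m t) \<le> payoff M W \<xi> T a b \<epsilon> \<alpha> (\<lambda>t _. m t)) \<and>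
     (\<forall>t\<in>{0..T}. m t = prob_space.expectation M (state W \<xi> \<alpha> t))"

text \<open>
  \<open>(\<Lambda>, \<mu>)\<close> belongs to the class \<open>\<G>\<^sub>l\<close>, with associated random variable \<open>Z\<close>. The feedback
  relation for \<open>\<Lambda>\<close> is implicit, since the state process is itself driven by \<open>\<Lambda>\<close>.
\<close>

definition in_G_l ::
  "'a measure \<Rightarrow> (real \<Rightarrow> 'a measure) \<Rightarrow> (real \<Rightarrow> 'a \<Rightarrow> real) \<Rightarrow> ('a \<Rightarrow> real) \<Rightarrow> real \<Rightarrow>
   (real \<Rightarrow> real) \<Rightarrow> (real \<Rightarrow> 'a \<Rightarrow> real) \<Rightarrow> (real \<Rightarrow> 'a \<Rightarrow> real) \<Rightarrow> ('a \<Rightarrow> real) \<Rightarrow> bool" where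
  "in_G_l M F W \<xi> T \<phi> \<Lambda> \<mu> Z \<longleftrightarrow>
     correlated_flow M F W \<xi> T \<Lambda> \<mu> \<and>
     Z \<in> borel_measurable (F 0) \<and>
     integrable M (\<lambda>\<omega>. (Z \<omega>)\<^sup>2) \<and>
     indep_of_data M T W \<xi> borel Z \<and>
     (AE \<omega> in M. \<forall>t\<in>{0..T}. \<mu> t \<omega> = prob_space.expectation M \<xi> + t * Z \<omega>) \<and>
     (AE \<omega> in M. \<forall>t\<in>{0..T}. \<Lambda> t \<omega> = \<phi> t * (\<mu> t \<omega> - state W \<xi> \<Lambda> t \<omega>) + Z \<omega>)"

end

theory Submission
  imports Defs
begin

text \<open>
  The flow recommended to the players is the equilibrium recentred: if \<open>Y\<close> solves
  \<open>dY = - \<phi> Y dt + dW\<close>, \<open>Y\<^sub>0 = \<xi> - \<nu>\<^sub>1\<close>, then the equilibrium state is \<open>\<nu>\<^sub>1 + Y\<close> with control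
  \<open>- \<phi> Y\<close>, while a flow of class \<open>\<G>\<^sub>l\<close> has state \<open>\<mu> + Y\<close> with control \<open>- \<phi> Y + Z\<close>. As \<open>Z\<close> is
  orthogonal to \<open>Y\<close>, the two payoffs differ by a polynomial in \<open>T\<close> and the moments of \<open>Z\<close>.

  An equilibrium is identified from optimality alone. The payoff is concave quadratic in the
  control; perturbing by deterministic controls forces \<open>m = \<nu>\<^sub>1\<close>, and \<open>- \<phi> Y\<close> satisfies the
  first-order condition, hence is optimal against \<open>\<nu>\<^sub>1\<close> and yields the equilibrium payoff.
\<close>

section \<open>Square integrable functions\<close>

text \<open>Why \<open>- \<phi> Y\<close> is stationary: let \<open>D\<close> be the primitive of a
  perturbation \<open>\<delta>\<close> of the control. Formally the product
  \<open>\<phi> Y D\<close> has drift \<open>\<phi> Y \<delta> - \<epsilon> Y D\<close>, because the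
  equation for \<open>\<phi>\<close> contributes \<open>(\<phi>\<^sup>2 - \<epsilon>) Y D\<close>
  and the drift of \<open>Y\<close> removes the \<open>\<phi>\<^sup>2\<close> part. Up to sign this
  is the first variation of the payoff, and \<open>\<phi> T = 0\<close> kills the boundary term, so
  that only a centred martingale term remains. The obstacle is regularity: \<open>\<delta>\<close>
  is merely progressive and square integrable, and \<open>Y\<close> has no differentiable paths.
  Hence \<open>Y\<close> is split into a continuously differentiable part and \<open>W\<close>, and
  all integrations by parts are carried out path by path with Lebesgue integrals.

  The comparison of payoffs is explicit because the tracking error is the same process
  \<open>Y\<close> in both situations. The \<open>\<epsilon>\<close> terms cancel, and what remains
  has an expectation polynomial in time. Its integral has the coefficients \<open>T^2 / 2\<close>,
  \<open>b * T^3 / 6\<close> and \<open>T / 2\<close>; the common factor \<open>T / 2\<close> leaves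
  the expression whose sign decides.\<close>

definition sq_integrable :: "'b measure \<Rightarrow> ('b \<Rightarrow> real) \<Rightarrow> bool" where
  "sq_integrable N f \<longleftrightarrow> f \<in> borel_measurable N \<and> integrable N (\<lambda>x. (f x)\<^sup>2)"

lemma sq_integrable_power2: "sq_integrable N f \<Longrightarrow> integrable N (\<lambda>x. (f x)\<^sup>2)"
  by (simp add: sq_integrable_def)

lemma sq_integrable_mult_integrable:
  assumes "sq_integrable N f" "sq_integrable N g"
  shows "integrable N (\<lambda>x. f x * g x)"
proof (rule Bochner_Integration.integrable_bound)
  show "integrable N (\<lambda>x. (f x)\<^sup>2 + (g x)\<^sup>2)"
    using assms by (simp add: sq_integrable_def)
  show "(\<lambda>x. f x * g x) \<in> borel_measurable N"
    using assms by (auto simp: sq_integrable_def intro!: borel_measurable_times)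
  have "\<bar>u * v\<bar> \<le> u\<^sup>2 + v\<^sup>2" for u v :: real
  proof -
    have "0 \<le> \<bar>u\<bar> * \<bar>v\<bar>" by simp
    then show ?thesis
      using sum_squares_bound[of "\<bar>u\<bar>" "\<bar>v\<bar>"] unfolding abs_mult power2_abs by linarith
  qed
  then show "AE x in N. norm (f x * g x) \<le> norm ((f x)\<^sup>2 + (g x)\<^sup>2)"
    by simp
qed

lemma sq_integrable_add:
  assumes "sq_integrable N f" "sq_integrable N g"
  shows "sq_integrable N (\<lambda>x. f x + g x)"
  using assms sq_integrable_mult_integrable[OF assms]
  by (auto simp: sq_integrable_def power2_sum mult.assoc)

lemma sq_integrable_cmult: "sq_integrable N f \<Longrightarrow> sq_integrable N (\<lambda>x. c * f x)"
  by (auto simp: sq_integrable_def power_mult_distrib)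

lemma sq_integrable_minus: "sq_integrable N f \<Longrightarrow> sq_integrable N (\<lambda>x. - f x)"
  by (auto simp: sq_integrable_def)

lemma sq_integrable_diff:
  assumes "sq_integrable N f" "sq_integrable N g"
  shows "sq_integrable N (\<lambda>x. f x - g x)"
  using sq_integrable_add[OF assms(1) sq_integrable_minus[OF assms(2)]] by simp

lemma sq_integrable_bounded_mult:
  assumes "sq_integrable N f" "g \<in> borel_measurable N" "\<And>x. x \<in> space N \<Longrightarrow> \<bar>g x\<bar> \<le> C"
  shows "sq_integrable N (\<lambda>x. g x * f x)"
  unfolding sq_integrable_def
proof
  show m: "(\<lambda>x. g x * f x) \<in> borel_measurable N"
    using assms by (auto simp: sq_integrable_def intro!: borel_measurable_times)
  show "integrable N (\<lambda>x. (g x * f x)\<^sup>2)"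
  proof (rule Bochner_Integration.integrable_bound)
    show "integrable N (\<lambda>x. C\<^sup>2 * (f x)\<^sup>2)"
      using assms by (simp add: sq_integrable_def)
    show "(\<lambda>x. (g x * f x)\<^sup>2) \<in> borel_measurable N"
      using m by measurable
    show "AE x in N. norm ((g x * f x)\<^sup>2) \<le> norm (C\<^sup>2 * (f x)\<^sup>2)"
      using assms(3) by (intro AE_I2) (auto simp: power_mult_distrib abs_le_square_iff[symmetric]
        intro!: mult_right_mono order_trans[OF assms(3)])
  qed
qed

lemma sq_integrable_cong_AE:
  assumes "sq_integrable N f" "g \<in> borel_measurable N" "AE x in N. g x = f x"
  shows "sq_integrable N g"
proof -
  have "integrable N (\<lambda>x. (g x)\<^sup>2) \<longleftrightarrow> integrable N (\<lambda>x. (f x)\<^sup>2)"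
    using assms by (intro integrable_cong_AE) (auto simp: sq_integrable_def)
  with assms show ?thesis by (simp add: sq_integrable_def)
qed

lemma (in finite_measure) sq_integrable_const: "sq_integrable M (\<lambda>_. c)"
  by (simp add: sq_integrable_def)

lemma (in finite_measure) sq_integrable_integrable: "sq_integrable M f \<Longrightarrow> integrable M f"
  using sq_integrable_mult_integrable[of M f "\<lambda>_. 1"] sq_integrable_const by simp

section \<open>Measurability of processes\<close>

text \<open>A finite measure on a space of its own instead of a set integral: products with the
  probability space and Fubini then apply directly, and its measurable sets are those occurring in
  progressive measurability.\<close>

abbreviation time_measure :: "real \<Rightarrow> real measure" where
  "time_measure t \<equiv> restrict_space lborel {0..t}"

lemma finite_measure_time: "finite_measure (time_measure t)"
  by (auto intro!: finite_measure_restrict_space simp: emeasure_lborel_Icc_eq finite_measureI space_restrict_space emeasure_restrict_space)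

lemma space_time [simp]: "space (time_measure t) = {0..t}"
  by (simp add: space_restrict_space)

lemma sets_time: "sets (time_measure t) = sets (restrict_space borel {0..t})"
  by (intro restrict_space_sets_cong) auto

lemma measurable_time_pair:
  "measurable (time_measure t \<Otimes>\<^sub>M G) N = measurable (restrict_space borel {0..t} \<Otimes>\<^sub>M G) N"
  by (intro measurable_cong_sets sets_pair_measure_cong sets_time refl)

lemma continuous_on_measurable_time:
  "continuous_on {0..t} (g :: real \<Rightarrow> real) \<Longrightarrow> g \<in> borel_measurable (time_measure t)"
  using borel_measurable_continuous_on_restrict[of "{0..t}" g]
  by (simp add: measurable_cong_sets[OF sets_time refl])

text \<open>A moving endpoint becomes an indicator under a fixed measure. In this form a primitive
  is visibly measurable in its endpoint and open to Fubini.\<close>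

lemma set_integral_time:
  fixes f :: "real \<Rightarrow> real"
  assumes "s \<le> t"
  shows "(LBINT u:{0..s}. f u) = (\<integral>u. indicator {0..s} u * f u \<partial>time_measure t)"
  unfolding set_lebesgue_integral_def using assms
  by (subst Bochner_Integration.integral_restrict_space) (auto intro!: Bochner_Integration.integral_cong simp: indicator_def)

lemma set_integral_time_full:
  fixes f :: "real \<Rightarrow> real"
  shows "(LBINT u:{0..t}. f u) = (\<integral>u. f u \<partial>time_measure t)"
  unfolding set_lebesgue_integral_def
  by (subst Bochner_Integration.integral_restrict_space) (auto intro!: Bochner_Integration.integral_cong simp: indicator_def)

text \<open>Each path is the limit of its values on the grid of mesh \<open>1 / Suc n\<close>, and
  each approximation involves only countably many times, so measurability at fixed times suffices.
  With \<open>G\<close> a member of a filtration this yields progressive measurability.\<close>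

lemma continuous_process_measurable:
  fixes f :: "real \<Rightarrow> 'a \<Rightarrow> real"
  assumes f: "\<And>s. s \<in> {0..t} \<Longrightarrow> f s \<in> borel_measurable G"
    and cont: "\<And>\<omega>. \<omega> \<in> space G \<Longrightarrow> continuous_on {0..t} (\<lambda>s. f s \<omega>)"
  shows "(\<lambda>p. f (fst p) (snd p)) \<in> borel_measurable (time_measure t \<Otimes>\<^sub>M G)"
proof (rule borel_measurable_LIMSEQ_real)
  \<comment> \<open>Rounding down keeps the grid time inside \<open>{0..t}\<close>; rounding up
    could leave the interval.\<close>
  define d :: "nat \<Rightarrow> real \<Rightarrow> nat" where "d n s = nat \<lfloor>s * Suc n\<rfloor>" for n s
  have d: "real (d n s) / Suc n \<le> s" "s - 1 / Suc n \<le> real (d n s) / Suc n" if "0 \<le> s" for n s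
  proof -
    have e: "real (d n s) = of_int \<lfloor>s * Suc n\<rfloor>"
      using that by (simp add: d_def)
    show "real (d n s) / Suc n \<le> s"
      unfolding e by (simp add: divide_le_eq)
    have "s * Suc n - 1 \<le> of_int \<lfloor>s * Suc n\<rfloor>" by linarith
    then have "(s * Suc n - 1) / Suc n \<le> of_int \<lfloor>s * Suc n\<rfloor> / Suc n"
      by (rule divide_right_mono) simp
    then show "s - 1 / Suc n \<le> real (d n s) / Suc n"
      unfolding e by (simp add: diff_divide_distrib)
  qed
  \<comment> \<open>The value \<open>0\<close> serves the grid times beyond \<open>t\<close>, where
    \<open>f\<close> need not be measurable; by \<open>in_t\<close> below it is never taken on the
    space.\<close>
  define u where "u n p = (if real (d n (fst p)) / Suc n \<in> {0..t}
      then f (real (d n (fst p)) / Suc n) (snd p) else 0)" for n and p :: "real \<times> 'a"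
  show "u n \<in> borel_measurable (time_measure t \<Otimes>\<^sub>M G)" for n
    unfolding u_def
  proof (rule measurable_compose_countable[where g = "\<lambda>p. d n (fst p)"])
    show "(\<lambda>p. d n (fst p)) \<in> measurable (time_measure t \<Otimes>\<^sub>M G) (count_space UNIV)"
    proof -
      have "d n \<in> measurable (time_measure t) (count_space UNIV)"
        unfolding d_def by (intro measurable_restrict_space1) measurable
      then show ?thesis by measurable
    qed
    show "(\<lambda>p. if real i / Suc n \<in> {0..t} then f (real i / Suc n) (snd p) else 0)
        \<in> borel_measurable (time_measure t \<Otimes>\<^sub>M G)" for i
      using f[of "real i / Suc n"] by (cases "real i / Suc n \<in> {0..t}") auto
  qed
  fix p assume "p \<in> space (time_measure t \<Otimes>\<^sub>M G)"
  then have p: "fst p \<in> {0..t}" "snd p \<in> space G" by (auto simp: space_pair_measure)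
  have in_t: "real (d n (fst p)) / Suc n \<in> {0..t}" for n
    using d(1)[of "fst p" n] p(1) by auto
  have lim: "(\<lambda>n. real (d n (fst p)) / Suc n) \<longlonglongrightarrow> fst p"
  proof (rule tendsto_sandwich)
    show "\<forall>\<^sub>F n in sequentially. fst p - 1 / Suc n \<le> real (d n (fst p)) / Suc n"
      using d(2)[of "fst p"] p(1) by auto
    show "\<forall>\<^sub>F n in sequentially. real (d n (fst p)) / Suc n \<le> fst p"
      using d(1)[of "fst p"] p(1) by auto
    show "(\<lambda>n. fst p - 1 / Suc n) \<longlonglongrightarrow> fst p"
      using tendsto_diff[OF tendsto_const LIMSEQ_inverse_real_of_nat, of "fst p"]
      by (simp add: inverse_eq_divide)
  qed simp
  have "(\<lambda>n. f (real (d n (fst p)) / Suc n) (snd p)) \<longlonglongrightarrow> f (fst p) (snd p)"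
    using cont[OF p(2)] lim p(1) in_t
    by (auto simp: continuous_on_sequentially o_def)
  then show "(\<lambda>n. u n p) \<longlonglongrightarrow> f (fst p) (snd p)"
    using in_t by (simp add: u_def)
qed

text \<open>The endpoint enters through an indicator in both time variables, and integrating out one
  of them preserves measurability. As \<open>G\<close> may be a member of a filtration, primitives
  of progressive processes remain adapted.\<close>

lemma primitive_measurable:
  fixes f :: "real \<Rightarrow> 'a \<Rightarrow> real"
  assumes f: "(\<lambda>p. f (fst p) (snd p)) \<in> borel_measurable (time_measure t \<Otimes>\<^sub>M G)"
  shows "(\<lambda>p. LBINT u:{0..fst p}. f u (snd p)) \<in> borel_measurable (time_measure t \<Otimes>\<^sub>M G)"
proof -
  interpret L: finite_measure "time_measure t" by (rule finite_measure_time)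
  have c: "(\<lambda>x. (snd x, snd (fst x))) \<in>
      measurable ((time_measure t \<Otimes>\<^sub>M G) \<Otimes>\<^sub>M time_measure t) (time_measure t \<Otimes>\<^sub>M G)"
    by measurable
  have ff: "(\<lambda>x. f (snd x) (snd (fst x))) \<in> borel_measurable ((time_measure t \<Otimes>\<^sub>M G) \<Otimes>\<^sub>M time_measure t)"
    using measurable_compose[OF c f] by simp
  have id: "(\<lambda>x. x) \<in> borel_measurable (time_measure t)"
    by (intro measurable_restrict_space1) simp
  have [measurable]: "(\<lambda>x. fst (fst x)) \<in> borel_measurable ((time_measure t \<Otimes>\<^sub>M G) \<Otimes>\<^sub>M time_measure t)"
      "(\<lambda>x. snd x) \<in> borel_measurable ((time_measure t \<Otimes>\<^sub>M G) \<Otimes>\<^sub>M time_measure t)"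
    by (rule measurable_compose[OF measurable_compose[OF measurable_fst measurable_fst] id],
        rule measurable_compose[OF measurable_snd id])
  have "(\<lambda>x. (if 0 \<le> snd x \<and> snd x \<le> fst (fst x) then 1 else 0) * f (snd x) (snd (fst x)))
      \<in> borel_measurable ((time_measure t \<Otimes>\<^sub>M G) \<Otimes>\<^sub>M time_measure t)"
    using ff by measurable
  then have "(\<lambda>p. \<integral>u. (if 0 \<le> u \<and> u \<le> fst p then 1 else 0) * f u (snd p) \<partial>time_measure t)
      \<in> borel_measurable (time_measure t \<Otimes>\<^sub>M G)"
    by (intro L.borel_measurable_lebesgue_integral) (simp add: case_prod_beta')
  then show ?thesis
  proof (rule measurable_cong[THEN iffD1, rotated])
    fix p assume "p \<in> space (time_measure t \<Otimes>\<^sub>M G)"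
    then have "fst p \<le> t" by (auto simp: space_pair_measure)
    then show "(\<integral>u. (if 0 \<le> u \<and> u \<le> fst p then 1 else 0) * f u (snd p) \<partial>time_measure t) =
        (LBINT u:{0..fst p}. f u (snd p))"
      by (subst set_integral_time) (auto intro!: Bochner_Integration.integral_cong simp: indicator_def)
  qed
qed

section \<open>Primitives\<close>

lemma continuous_on_integrable_time:
  fixes g :: "real \<Rightarrow> real"
  assumes "continuous_on {0..t} g"
  shows "integrable (time_measure t) g"
  using borel_integrable_atLeastAtMost'[OF assms]
  by (subst Bochner_Integration.integrable_restrict_space) (auto simp: set_integrable_def)

lemma set_integral_continuous:
  fixes g :: "real \<Rightarrow> real"
  assumes "continuous_on {0..t} g"
  shows "(LBINT u:{0..t}. g u) = integral {0..t} g"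
  by (intro set_borel_integral_eq_integral borel_integrable_atLeastAtMost' assms)

lemma primitive_has_derivative:
  fixes g :: "real \<Rightarrow> real"
  assumes g: "continuous_on {0..T} g" and t: "t \<in> {0..T}"
  shows "((\<lambda>t. LBINT u:{0..t}. g u) has_real_derivative g t) (at t within {0..T})"
proof (rule has_field_derivative_transform_within[OF integral_has_real_derivative[OF g t] zero_less_one t])
  fix s assume "s \<in> {0..T}"
  then show "integral {0..s} g = (LBINT u:{0..s}. g u)"
    using set_integral_continuous[OF continuous_on_subset[OF g, of "{0..s}"]] by auto
qed

lemma set_integral_derivative:
  fixes g G :: "real \<Rightarrow> real"
  assumes "0 \<le> t" "continuous_on {0..t} g"
    and "\<And>s. s \<in> {0..t} \<Longrightarrow> (G has_real_derivative g s) (at s within {0..t})"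
  shows "(LBINT u:{0..t}. g u) = G t - G 0"
  unfolding set_integral_continuous[OF assms(2)]
  by (rule integral_unique, rule fundamental_theorem_of_calculus[OF assms(1)])
    (use assms(3) in \<open>auto simp: has_real_derivative_iff_has_vector_derivative\<close>)

lemma continuous_on_has_derivative:
  fixes G g :: "real \<Rightarrow> real"
  assumes "\<And>s. s \<in> S \<Longrightarrow> (G has_real_derivative g s) (at s within S)"
  shows "continuous_on S G"
  using assms by (intro DERIV_continuous_on) auto

lemma primitive_bound:
  fixes f :: "real \<Rightarrow> real"
  assumes f: "integrable (time_measure T) f" and t: "t \<in> {0..T}"
  shows "\<bar>LBINT u:{0..t}. f u\<bar> \<le> (\<integral>u. \<bar>f u\<bar> \<partial>time_measure T)"
proof -
  have [measurable]: "f \<in> borel_measurable (time_measure T)" using f by auto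
  have m: "{0..t} \<in> sets (time_measure T)"
    using t by (subst sets_restrict_space_iff) auto
  have "\<bar>LBINT u:{0..t}. f u\<bar> \<le> (\<integral>u. \<bar>indicator {0..t} u * f u\<bar> \<partial>time_measure T)"
    using t by (subst set_integral_time[of t T]) auto
  also have "\<dots> \<le> (\<integral>u. \<bar>f u\<bar> \<partial>time_measure T)"
  proof (intro integral_mono integrable_abs)
    show "integrable (time_measure T) (\<lambda>u. indicator {0..t} u * f u)"
      using integrable_real_mult_indicator[OF m f] by (simp add: mult.commute)
  qed (use f in \<open>auto simp: abs_mult indicator_def\<close>)
  finally show ?thesis .
qed

text \<open>
  Fubini's theorem on the triangle \<open>s \<le> t\<close> replaces the product rule for the merely
  absolutely continuous primitive of \<open>\<delta>\<close>.
\<close>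

lemma integral_by_parts_primitive:
  fixes G g \<delta> :: "real \<Rightarrow> real"
  assumes T: "0 \<le> T" and \<delta>: "integrable (time_measure T) \<delta>" and g: "continuous_on {0..T} g"
    and G: "\<And>t. t \<in> {0..T} \<Longrightarrow> (G has_real_derivative g t) (at t within {0..T})" and GT: "G T = 0"
  shows "(\<integral>t. G t * \<delta> t \<partial>time_measure T) = - (\<integral>t. g t * (LBINT s:{0..t}. \<delta> s) \<partial>time_measure T)"
proof -
  let ?L = "time_measure T"
  interpret L: finite_measure ?L by (rule finite_measure_time)
  interpret LL: pair_sigma_finite ?L ?L ..
  obtain C where C: "\<And>t. t \<in> {0..T} \<Longrightarrow> \<bar>g t\<bar> \<le> C"
    using compact_imp_bounded[OF compact_continuous_image[OF g compact_Icc]]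
    unfolding bounded_iff by (metis imageI real_norm_def)
  have [measurable]: "g \<in> borel_measurable ?L" "\<delta> \<in> borel_measurable ?L"
    using continuous_on_measurable_time[OF g] \<delta> by auto
  have id: "(\<lambda>x. x) \<in> borel_measurable ?L"
    by (intro measurable_restrict_space1) simp
  have [measurable]: "fst \<in> borel_measurable (?L \<Otimes>\<^sub>M ?L)" "snd \<in> borel_measurable (?L \<Otimes>\<^sub>M ?L)"
    by (rule measurable_compose[OF measurable_fst id], rule measurable_compose[OF measurable_snd id])
  \<comment> \<open>\<open>k\<close> lives on the triangle \<open>fst p \<le> snd p\<close>.
    Integrating out the second variable gives \<open>(G T - G s) * \<delta> s\<close>, which is
    \<open>- (G s * \<delta> s)\<close> by \<open>GT\<close>; integrating out the first gives
    \<open>g t\<close> times the primitive of \<open>\<delta>\<close>.\<close>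
  define k where "k p = (if fst p \<le> snd p then 1 else 0) * (g (snd p) * \<delta> (fst p))" for p :: "real \<times> real"
  have k_meas [measurable]: "k \<in> borel_measurable (?L \<Otimes>\<^sub>M ?L)"
    unfolding k_def by measurable
  have dom: "integrable (?L \<Otimes>\<^sub>M ?L) (\<lambda>p. C * \<delta> (fst p))"
  proof (rule LL.Fubini_integrable)
    show "integrable ?L (\<lambda>x. \<integral>y. norm (C * \<delta> (fst (x, y))) \<partial>?L)"
      using \<delta> by (simp add: abs_mult)
  qed auto
  have k_int: "integrable (?L \<Otimes>\<^sub>M ?L) k"
  proof (rule Bochner_Integration.integrable_bound[OF dom k_meas], rule AE_I2)
    fix p assume "p \<in> space (?L \<Otimes>\<^sub>M ?L)"
    then have "\<bar>g (snd p)\<bar> \<le> \<bar>C\<bar>" using C[of "snd p"] by (auto simp: space_pair_measure)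
    then show "norm (k p) \<le> norm (C * \<delta> (fst p))"
      by (auto simp: k_def abs_mult intro: mult_right_mono)
  qed
  have "(\<integral>s. (\<integral>t. k (s, t) \<partial>?L) \<partial>?L) = (\<integral>t. (\<integral>s. k (s, t) \<partial>?L) \<partial>?L)"
    using LL.Fubini_integral[of "\<lambda>s t. k (s, t)"] k_int by simp
  moreover have "(\<integral>s. (\<integral>t. k (s, t) \<partial>?L) \<partial>?L) = (\<integral>s. - (G s * \<delta> s) \<partial>?L)"
  proof (rule Bochner_Integration.integral_cong[OF refl])
    fix s assume "s \<in> space ?L"
    then have s: "s \<in> {0..T}" by simp
    have gs: "continuous_on {s..T} g" using continuous_on_subset[OF g] s by auto
    have "(\<integral>t. k (s, t) \<partial>?L) = (\<integral>t. \<delta> s * ((if s \<le> t then 1 else 0) * g t) \<partial>?L)"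
      by (intro Bochner_Integration.integral_cong) (auto simp: k_def)
    also have "\<dots> = \<delta> s * (\<integral>t. (if s \<le> t then 1 else 0) * g t \<partial>?L)"
      by (rule integral_mult_right_zero)
    also have "(\<integral>t. (if s \<le> t then 1 else 0) * g t \<partial>?L) = (LBINT t:{s..T}. g t)"
      unfolding set_lebesgue_integral_def using s
      by (subst Bochner_Integration.integral_restrict_space) (auto intro!: Bochner_Integration.integral_cong simp: indicator_def)
    also have "\<dots> = integral {s..T} g"
      by (intro set_borel_integral_eq_integral borel_integrable_atLeastAtMost' gs)
    also have "\<dots> = G T - G s"
      by (rule integral_unique, rule fundamental_theorem_of_calculus)
        (use s in \<open>auto simp: has_real_derivative_iff_has_vector_derivative[symmetric]
          intro!: DERIV_subset[OF G]\<close>)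
    finally show "(\<integral>t. k (s, t) \<partial>?L) = - (G s * \<delta> s)" by (simp add: GT)
  qed
  moreover have "(\<integral>t. (\<integral>s. k (s, t) \<partial>?L) \<partial>?L) = (\<integral>t. g t * (LBINT s:{0..t}. \<delta> s) \<partial>?L)"
  proof (rule Bochner_Integration.integral_cong[OF refl])
    fix t assume "t \<in> space ?L"
    then have t: "t \<in> {0..T}" by simp
    have "(\<integral>s. k (s, t) \<partial>?L) = (\<integral>s. g t * (indicator {0..t} s * \<delta> s) \<partial>?L)"
      by (intro Bochner_Integration.integral_cong) (auto simp: k_def indicator_def)
    also have "\<dots> = g t * (\<integral>s. indicator {0..t} s * \<delta> s \<partial>?L)"
      by (rule integral_mult_right_zero)
    finally show "(\<integral>s. k (s, t) \<partial>?L) = g t * (LBINT s:{0..t}. \<delta> s)"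
      using t by (simp add: set_integral_time[of t T])
  qed
  ultimately show ?thesis by simp
qed

lemma set_integrable_time:
  fixes f :: "real \<Rightarrow> real"
  assumes "integrable (time_measure T) f" "t \<le> T"
  shows "set_integrable lborel {0..t} f"
proof (rule set_integrable_subset)
  show "set_integrable lborel {0..T} f"
    using assms(1) unfolding set_integrable_def
    by (subst (asm) Bochner_Integration.integrable_restrict_space) auto
qed (use assms in auto)

text \<open>For a merely integrable integrand, continuity is what the uniqueness argument for the
  implicit feedback equation starts from.\<close>

lemma primitive_continuous:
  fixes f :: "real \<Rightarrow> real"
  assumes f: "integrable (time_measure T) f"
  shows "continuous_on {0..T} (\<lambda>t. LBINT u:{0..t}. f u)"
proof -
  have "f integrable_on {0..T}"
    by (intro set_borel_integral_eq_integral set_integrable_time[OF f]) simp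
  then have "continuous_on {0..T} (\<lambda>t. integral {0..t} f)"
    by (rule indefinite_integral_continuous_1)
  moreover have "(LBINT u:{0..t}. f u) = integral {0..t} f" if "t \<in> {0..T}" for t
    using that by (intro set_borel_integral_eq_integral set_integrable_time[OF f]) simp
  ultimately show ?thesis
    using continuous_on_cong[of "{0..T}" "{0..T}" "\<lambda>t. LBINT u:{0..t}. f u" "\<lambda>t. integral {0..t} f"] by blast
qed

section \<open>Square integrable processes on the stochastic basis\<close>

text \<open>Independence is given for families of events: a whole member of the filtration, or the
  preimages under the pair of initial value and noise. Shrinking them to the preimages of two
  variables, which are stable under intersection, brings the product rule for expectations within
  reach.\<close>

lemma (in prob_space) indep_set_imp_indep_var:
  assumes X: "X \<in> measurable M N1" and Y: "Y \<in> measurable M N2"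
    and indep: "indep_set A B"
    and A: "{X -` S \<inter> space M | S. S \<in> sets N1} \<subseteq> A" and B: "{Y -` S \<inter> space M | S. S \<in> sets N2} \<subseteq> B"
  shows "indep_var N1 X N2 Y"
proof -
  have "indep_set {X -` S \<inter> space M | S. S \<in> sets N1} {Y -` S \<inter> space M | S. S \<in> sets N2}"
    using indep A B unfolding indep_set_def
    by (elim indep_sets_mono_sets) (auto split: bool.split)
  moreover have "Int_stable {Z -` S \<inter> space M | S. S \<in> sets N}" for Z :: "'a \<Rightarrow> 'd" and N
  proof (rule Int_stableI, clarify)
    fix S S' assume "S \<in> sets N" "S' \<in> sets N"
    then show "\<exists>S''. (Z -` S \<inter> space M) \<inter> (Z -` S' \<inter> space M) = Z -` S'' \<inter> space M \<and> S'' \<in> sets N"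
      by (intro exI[of _ "S \<inter> S'"]) auto
  qed
  ultimately show ?thesis
    unfolding indep_var_eq using X Y by (auto intro!: indep_set_sigma_sets)
qed

context emission_game
begin

interpretation L: finite_measure "time_measure T" by (rule finite_measure_time)
interpretation LM: pair_sigma_finite "time_measure T" M ..

abbreviation Q :: "(real \<times> 'a) measure" where
  "Q \<equiv> time_measure T \<Otimes>\<^sub>M M"

abbreviation sq_process :: "(real \<Rightarrow> 'a \<Rightarrow> real) \<Rightarrow> bool" where
  "sq_process f \<equiv> sq_integrable Q (\<lambda>p. f (fst p) (snd p))"

abbreviation F\<^sub>1 :: "real \<Rightarrow> 'a measure" where
  "F\<^sub>1 \<equiv> generated_filtration M T W \<xi>"

interpretation Q: finite_measure Q
  by (intro finite_measure_pair_measure) unfold_locales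

lemma measure_time [simp]: "measure (time_measure T) {0..T} = T"
  using T_pos by (simp add: measure_restrict_space)

lemma F_subalgebra: "t \<in> {0..T} \<Longrightarrow> subalgebra M (F t)"
  using usual by (simp add: usual_filtration_def)

lemma F_mono: "0 \<le> s \<Longrightarrow> s \<le> t \<Longrightarrow> t \<le> T \<Longrightarrow> sets (F s) \<subseteq> sets (F t)"
  using usual by (auto simp: usual_filtration_def)

lemma space_F: "t \<in> {0..T} \<Longrightarrow> space (F t) = space M"
  using F_subalgebra by (simp add: subalgebra_def)

lemma F_measurable_mono:
  assumes "f \<in> borel_measurable (F s)" "0 \<le> s" "s \<le> t" "t \<le> T"
  shows "f \<in> borel_measurable (F t)"
  by (rule measurable_from_subalg[OF _ assms(1)])
    (use assms F_mono[of s t] space_F[of s] space_F[of t] in \<open>auto simp: subalgebra_def\<close>)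

lemma F_measurable: "f \<in> borel_measurable (F t) \<Longrightarrow> t \<in> {0..T} \<Longrightarrow> f \<in> borel_measurable M"
  using measurable_from_subalg[OF F_subalgebra] by blast

text \<open>The exceptional set lies in the rectangle \<open>{0..T} \<times> N\<close> with
  \<open>N\<close> null, so a statement about whole paths passes to the product space.\<close>

lemma AE_Q:
  assumes "AE \<omega> in M. \<forall>t\<in>{0..T}. P t \<omega>"
  shows "AE p in Q. P (fst p) (snd p)"
proof -
  obtain N where N: "N \<in> null_sets M" "{\<omega>\<in>space M. \<not> (\<forall>t\<in>{0..T}. P t \<omega>)} \<subseteq> N"
    using assms by (auto simp: eventually_ae_filter)
  have "{0..T} \<times> N \<in> null_sets Q"
    using N(1) sets.top[of "time_measure T"] by (intro times_in_null_sets2) auto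
  moreover have "{p\<in>space Q. \<not> P (fst p) (snd p)} \<subseteq> {0..T} \<times> N"
    using N(2) by (force simp: space_pair_measure)
  ultimately show ?thesis by (rule AE_I')
qed

lemma integrable_Q_snd:
  fixes h :: "'a \<Rightarrow> real"
  assumes h: "integrable M h"
  shows "integrable Q (\<lambda>p. h (snd p))"
proof (rule LM.Fubini_integrable)
  show "(\<lambda>p. h (snd p)) \<in> borel_measurable Q" using h by measurable
qed (use h in auto)

lemma sq_integrable_Q_snd: "sq_integrable M h \<Longrightarrow> sq_integrable Q (\<lambda>p. h (snd p))"
  unfolding sq_integrable_def by (auto intro: integrable_Q_snd)

lemma integrable_Q_fst:
  fixes h :: "real \<Rightarrow> real"
  assumes h: "integrable (time_measure T) h"
  shows "integrable Q (\<lambda>p. h (fst p))"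
proof (rule LM.Fubini_integrable)
  show "(\<lambda>p. h (fst p)) \<in> borel_measurable Q" using h by measurable
  show "integrable (time_measure T) (\<lambda>x. \<integral>y. norm (h (fst (x, y))) \<partial>M)"
    using h by (simp add: prob_space)
qed auto

lemma sq_process_fst:
  assumes "continuous_on {0..T} g"
  shows "sq_process (\<lambda>t _. g t)"
proof -
  have "integrable (time_measure T) (\<lambda>t. (g t)\<^sup>2)"
    by (intro continuous_on_integrable_time continuous_intros assms)
  then show ?thesis
    using continuous_on_measurable_time[OF assms] unfolding sq_integrable_def
    by (auto intro!: integrable_Q_fst)
qed

lemma sq_process_cont_mult:
  assumes f: "sq_process f" and g: "continuous_on {0..T} g"
  shows "sq_process (\<lambda>t \<omega>. g t * f t \<omega>)"
proof -
  obtain C where C: "\<forall>t\<in>{0..T}. \<bar>g t\<bar> \<le> C"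
    using compact_imp_bounded[OF compact_continuous_image[OF g compact_Icc]]
    unfolding bounded_iff by auto
  show ?thesis
    by (rule sq_integrable_bounded_mult[OF f, of _ C])
      (use continuous_on_measurable_time[OF g] C in \<open>auto simp: space_pair_measure\<close>)
qed

section \<open>Sections and iterated integrals of processes\<close>

lemma sq_process_section_time:
  assumes "sq_process f"
  shows "AE t in time_measure T. sq_integrable M (f t)"
proof -
  have m: "(\<lambda>p. f (fst p) (snd p)) \<in> borel_measurable Q"
    using assms by (simp add: sq_integrable_def)
  have "AE t in time_measure T. integrable M (\<lambda>\<omega>. (f t \<omega>)\<^sup>2)"
    using LM.AE_integrable_fst'[OF sq_integrable_power2[OF assms]] by simp
  with AE_space show ?thesis
  proof eventually_elim
    case (elim t)
    have "f t \<in> borel_measurable M"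
      using measurable_compose[OF measurable_Pair1'[OF elim(1)] m] by simp
    with elim(2) show ?case by (simp add: sq_integrable_def)
  qed
qed

lemma sq_process_section_sample:
  assumes "sq_process f"
  shows "AE \<omega> in M. sq_integrable (time_measure T) (\<lambda>t. f t \<omega>)"
proof -
  have m: "(\<lambda>p. f (fst p) (snd p)) \<in> borel_measurable Q"
    using assms by (simp add: sq_integrable_def)
  have "integrable Q (\<lambda>(t, \<omega>). (f t \<omega>)\<^sup>2)"
    using sq_integrable_power2[OF assms] by (simp add: case_prod_beta')
  then have "AE \<omega> in M. integrable (time_measure T) (\<lambda>t. (f t \<omega>)\<^sup>2)"
    by (rule LM.AE_integrable_snd)
  with AE_space show ?thesis
  proof eventually_elim
    case (elim \<omega>)
    have "(\<lambda>t. f t \<omega>) \<in> borel_measurable (time_measure T)"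
      using measurable_compose[OF measurable_Pair2'[OF elim(1)] m] by simp
    with elim(2) show ?case by (simp add: sq_integrable_def)
  qed
qed

lemma integral_Q_time:
  fixes f :: "real \<Rightarrow> 'a \<Rightarrow> real"
  assumes "integrable Q (\<lambda>p. f (fst p) (snd p))"
  shows "(\<integral>p. f (fst p) (snd p) \<partial>Q) = (\<integral>t. expectation (f t) \<partial>time_measure T)"
  using LM.integral_fst'[OF assms] by simp

lemma integral_Q_sample:
  fixes f :: "real \<Rightarrow> 'a \<Rightarrow> real"
  assumes "integrable Q (\<lambda>p. f (fst p) (snd p))"
  shows "(\<integral>p. f (fst p) (snd p) \<partial>Q) = expectation (\<lambda>\<omega>. \<integral>t. f t \<omega> \<partial>time_measure T)"
  using LM.integral_snd[of f] assms by (simp add: case_prod_beta')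

lemma integrable_time:
  fixes f :: "real \<Rightarrow> 'a \<Rightarrow> real"
  assumes "integrable Q (\<lambda>p. f (fst p) (snd p))"
  shows "integrable (time_measure T) (\<lambda>t. expectation (f t))"
  using LM.integrable_fst'[OF assms] by simp

lemma integrable_sample:
  fixes f :: "real \<Rightarrow> 'a \<Rightarrow> real"
  assumes "integrable Q (\<lambda>p. f (fst p) (snd p))"
  shows "integrable M (\<lambda>\<omega>. \<integral>t. f t \<omega> \<partial>time_measure T)"
  using LM.integrable_snd[of f] assms by (simp add: case_prod_beta')

lemma time_Cauchy_Schwarz:
  assumes f: "sq_integrable (time_measure T) f"
  shows "(\<integral>t. \<bar>f t\<bar> \<partial>time_measure T)\<^sup>2 \<le> T * (\<integral>t. (f t)\<^sup>2 \<partial>time_measure T)"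
proof -
  define A B where "A = (\<integral>t. \<bar>f t\<bar> \<partial>time_measure T)" and "B = (\<integral>t. (f t)\<^sup>2 \<partial>time_measure T)"
  \<comment> \<open>\<open>c\<close> is the time average of \<open>\<bar>f\<bar>\<close>. Expanding
    the nonnegative integral of \<open>(\<bar>f t\<bar> - c)\<^sup>2\<close> leaves
    \<open>B - c * A\<close>, and multiplication by \<open>T\<close> gives the inequality.\<close>
  define c where "c = A / T"
  have A: "A = c * T" using T_pos by (simp add: c_def)
  have i: "integrable (time_measure T) (\<lambda>t. \<bar>f t\<bar>)" "integrable (time_measure T) (\<lambda>t. (f t)\<^sup>2)"
    using L.sq_integrable_integrable[OF f] sq_integrable_power2[OF f] by simp_all
  have sq: "(u - c)\<^sup>2 = (u\<^sup>2 - 2 * c * u) + c\<^sup>2" for u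
    by (simp add: power2_diff mult_ac)
  have c: "integrable (time_measure T) (\<lambda>t. 2 * c * \<bar>f t\<bar>)" "integrable (time_measure T) (\<lambda>t. c\<^sup>2)"
    by (intro integrable_mult_right i(1), rule L.integrable_const)
  have "0 \<le> (\<integral>t. (\<bar>f t\<bar> - c)\<^sup>2 \<partial>time_measure T)" by simp
  also have "\<dots> = (\<integral>t. ((f t)\<^sup>2 - 2 * c * \<bar>f t\<bar>) + c\<^sup>2 \<partial>time_measure T)"
    by (simp only: sq power2_abs)
  also have "\<dots> = (B - 2 * c * A) + c\<^sup>2 * T"
    unfolding A_def B_def using i(2) c
    by (simp only: Bochner_Integration.integral_add Bochner_Integration.integral_diff
      Bochner_Integration.integrable_diff integral_mult_right_zero) simp
  also have "\<dots> = B - c * A"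
    by (simp add: A power2_eq_square)
  finally have "T * (c * A) \<le> T * B"
    using T_pos by (intro mult_left_mono) auto
  then show ?thesis
    unfolding A_def[symmetric] B_def[symmetric] by (simp add: A power2_eq_square mult_ac)
qed

text \<open>Path by path, Cauchy-Schwarz bounds the squared primitive at all times at once by
  \<open>T\<close> times the energy of the path. This bound does not depend on time and is
  integrable over the sample space.\<close>

lemma sq_process_primitive:
  assumes f: "sq_process f"
  shows "sq_process (\<lambda>t \<omega>. LBINT s:{0..t}. f s \<omega>)"
  unfolding sq_integrable_def
proof
  show m: "(\<lambda>p. LBINT s:{0..fst p}. f s (snd p)) \<in> borel_measurable Q"
    using f by (intro primitive_measurable) (simp add: sq_integrable_def)
  have i: "integrable M (\<lambda>\<omega>. \<integral>t. (f t \<omega>)\<^sup>2 \<partial>time_measure T)"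
    using LM.integrable_snd[of "\<lambda>t \<omega>. (f t \<omega>)\<^sup>2"] sq_integrable_power2[OF f]
    by (simp add: case_prod_beta')
  show "integrable Q (\<lambda>p. (LBINT s:{0..fst p}. f s (snd p))\<^sup>2)"
  proof (rule Bochner_Integration.integrable_bound)
    show "integrable Q (\<lambda>p. T * (\<integral>t. (f t (snd p))\<^sup>2 \<partial>time_measure T))"
      using integrable_Q_snd[OF i] by simp
    show "(\<lambda>p. (LBINT s:{0..fst p}. f s (snd p))\<^sup>2) \<in> borel_measurable Q"
      using m by measurable
    have "AE \<omega> in M. \<forall>t\<in>{0..T}. (LBINT s:{0..t}. f s \<omega>)\<^sup>2 \<le> T * (\<integral>t. (f t \<omega>)\<^sup>2 \<partial>time_measure T)"
      using sq_process_section_sample[OF f]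
    proof (eventually_elim, intro ballI)
      fix \<omega> t assume sq: "sq_integrable (time_measure T) (\<lambda>t. f t \<omega>)" and t: "t \<in> {0..T}"
      have "(LBINT s:{0..t}. f s \<omega>)\<^sup>2 \<le> (\<integral>s. \<bar>f s \<omega>\<bar> \<partial>time_measure T)\<^sup>2"
        using primitive_bound[OF L.sq_integrable_integrable[OF sq] t]
        by (intro abs_le_square_iff[THEN iffD1]) auto
      also have "\<dots> \<le> T * (\<integral>t. (f t \<omega>)\<^sup>2 \<partial>time_measure T)"
        by (rule time_Cauchy_Schwarz[OF sq])
      finally show "(LBINT s:{0..t}. f s \<omega>)\<^sup>2 \<le> T * (\<integral>t. (f t \<omega>)\<^sup>2 \<partial>time_measure T)" .
    qed
    from AE_Q[OF this] show "AE p in Q. norm ((LBINT s:{0..fst p}. f s (snd p))\<^sup>2)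
        \<le> norm (T * (\<integral>t. (f t (snd p))\<^sup>2 \<partial>time_measure T))"
      by eventually_elim (auto intro: order_trans[OF _ abs_ge_self])
  qed
qed

section \<open>Moments and independence\<close>

lemma xi_measurable_M: "\<xi> \<in> borel_measurable M"
  using F_measurable[OF xi_measurable] T_pos by simp

lemma xi_sq: "sq_integrable M \<xi>"
  using xi_measurable_M xi_square_integrable by (simp add: sq_integrable_def)

lemma W_adapted: "t \<in> {0..T} \<Longrightarrow> W t \<in> borel_measurable (F t)"
  using brownian by (simp add: brownian_motion_def)

lemma W_measurable_M: "t \<in> {0..T} \<Longrightarrow> W t \<in> borel_measurable M"
  using F_measurable W_adapted by blast

lemma W_continuous: "\<omega> \<in> space M \<Longrightarrow> continuous_on {0..T} (\<lambda>t. W t \<omega>)"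
  using brownian by (simp add: brownian_motion_def)

text \<open>The Gaussian law is prescribed only for increments over intervals of positive length. So
  \<open>W t\<close> is compared with \<open>W t - W 0\<close>, from which it differs on a null set,
  and \<open>t = 0\<close> is treated apart.\<close>

lemma W_moments:
  assumes t: "t \<in> {0..T}"
  shows "integrable M (\<lambda>\<omega>. (W t \<omega>)\<^sup>2)" "expectation (\<lambda>\<omega>. (W t \<omega>)\<^sup>2) = t" "expectation (W t) = 0"
proof -
  have W0: "AE \<omega> in M. W 0 \<omega> = 0"
    using brownian by (simp add: brownian_motion_def)
  note [measurable] = W_measurable_M[OF t] W_measurable_M[of 0]
  have "integrable M (\<lambda>\<omega>. (W t \<omega>)\<^sup>2) \<and> expectation (\<lambda>\<omega>. (W t \<omega>)\<^sup>2) = t \<and> expectation (W t) = 0"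
  proof (cases "t = 0")
    case True
    have "AE \<omega> in M. (W t \<omega>)\<^sup>2 = 0" "AE \<omega> in M. W t \<omega> = 0"
      using W0 True by (auto elim: eventually_mono)
    then have "integrable M (\<lambda>\<omega>. (W t \<omega>)\<^sup>2) \<longleftrightarrow> integrable M (\<lambda>_. 0 :: real)"
      "expectation (\<lambda>\<omega>. (W t \<omega>)\<^sup>2) = expectation (\<lambda>_. 0)" "expectation (W t) = expectation (\<lambda>_. 0)"
      by - (rule integrable_cong_AE integral_cong_AE; measurable; assumption)+
    then show ?thesis using True by simp
  next
    case False
    then have t0: "t > 0" using t by auto
    define X where "X \<omega> = W t \<omega> - W 0 \<omega>" for \<omega>
    have dist: "distributed M lborel X (normal_density 0 (sqrt (t - 0)))"
    proof -
      have "\<forall>s\<in>{0..T}. \<forall>t\<in>{s<..T}.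
          distributed M lborel (\<lambda>\<omega>. W t \<omega> - W s \<omega>) (normal_density 0 (sqrt (t - s)))"
        using brownian unfolding brownian_motion_def by blast
      from bspec[OF bspec[OF this, of 0], of t] show ?thesis
        unfolding X_def using t t0 T_pos by auto
    qed
    have X [measurable]: "X \<in> borel_measurable M"
      using dist by (simp add: distributed_def)
    have 1: "has_bochner_integral lborel (\<lambda>x. normal_density 0 (sqrt t) x * x\<^sup>2) t"
      using normal_moment_even[of "sqrt t" 0 1] t0 by (simp add: fact_numeral)
    have 2: "has_bochner_integral lborel (\<lambda>x. normal_density 0 (sqrt t) x * x) 0"
      using normal_moment_nz_1[of "sqrt t" 0] t0 by simp
    have "integrable M (\<lambda>\<omega>. (X \<omega>)\<^sup>2)"
      using 1 dist distributed_integrable[OF dist, of "\<lambda>x. x\<^sup>2"]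
      by (simp add: has_bochner_integral_iff)
    moreover have "expectation (\<lambda>\<omega>. (X \<omega>)\<^sup>2) = t"
      using 1 dist distributed_integral[OF dist, of "\<lambda>x. x\<^sup>2"]
      by (simp add: has_bochner_integral_iff)
    moreover have "expectation X = 0"
      using 2 dist distributed_integral[OF dist, of "\<lambda>x. x"]
      by (simp add: has_bochner_integral_iff)
    moreover have "AE \<omega> in M. (W t \<omega>)\<^sup>2 = (X \<omega>)\<^sup>2" "AE \<omega> in M. W t \<omega> = X \<omega>"
      using W0 by (auto simp: X_def elim: eventually_mono)
    then have "integrable M (\<lambda>\<omega>. (W t \<omega>)\<^sup>2) \<longleftrightarrow> integrable M (\<lambda>\<omega>. (X \<omega>)\<^sup>2)"
      "expectation (\<lambda>\<omega>. (W t \<omega>)\<^sup>2) = expectation (\<lambda>\<omega>. (X \<omega>)\<^sup>2)" "expectation (W t) = expectation X"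
      using X by - (rule integrable_cong_AE integral_cong_AE; measurable; assumption)+
    ultimately show ?thesis by simp
  qed
  then show "integrable M (\<lambda>\<omega>. (W t \<omega>)\<^sup>2)" "expectation (\<lambda>\<omega>. (W t \<omega>)\<^sup>2) = t" "expectation (W t) = 0"
    by auto
qed

lemma W_sq: "t \<in> {0..T} \<Longrightarrow> sq_integrable M (W t)"
  by (simp add: sq_integrable_def W_moments W_measurable_M)

lemma W_sq_process: "sq_process W"
  unfolding sq_integrable_def
proof
  show m: "(\<lambda>p. W (fst p) (snd p)) \<in> borel_measurable Q"
    by (intro continuous_process_measurable W_measurable_M W_continuous) auto
  show "integrable Q (\<lambda>p. (W (fst p) (snd p))\<^sup>2)"
  proof (rule LM.Fubini_integrable)
    show "(\<lambda>p. (W (fst p) (snd p))\<^sup>2) \<in> borel_measurable Q"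
      using m by measurable
    have "integrable (time_measure T) (\<lambda>x. \<integral>y. norm ((W (fst (x, y)) (snd (x, y)))\<^sup>2) \<partial>M)
        \<longleftrightarrow> integrable (time_measure T) (\<lambda>t. t)"
      by (intro Bochner_Integration.integrable_cong) (auto simp: W_moments)
    then show "integrable (time_measure T) (\<lambda>x. \<integral>y. norm ((W (fst (x, y)) (snd (x, y)))\<^sup>2) \<partial>M)"
      by (simp add: continuous_on_integrable_time)
    show "AE x in time_measure T. integrable M (\<lambda>y. (W (fst (x, y)) (snd (x, y)))\<^sup>2)"
      by (intro AE_I2) (auto simp: W_moments)
  qed
qed

text \<open>The increment of \<open>W\<close> after time \<open>s\<close> is independent of
  \<open>h\<close> and centred, so it drops out. The martingale property enters the whole argument
  only in this form.\<close>

lemma martingale_increment: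
  assumes st: "s \<in> {0..T}" "t \<in> {s..T}" and h: "h \<in> borel_measurable (F s)" "sq_integrable M h"
  shows "expectation (\<lambda>\<omega>. W t \<omega> * h \<omega>) = expectation (\<lambda>\<omega>. W s \<omega> * h \<omega>)"
proof (cases "s = t")
  case False
  then have st': "s \<in> {0..T}" "t \<in> {s<..T}" "t \<in> {0..T}" using st by auto
  define X where "X \<omega> = W t \<omega> - W s \<omega>" for \<omega>
  have X: "sq_integrable M X"
    unfolding X_def using st' by (intro sq_integrable_diff W_sq)
  have "indep_set (sets (F s)) {X -` A \<inter> space M | A. A \<in> sets borel}"
    using brownian st' unfolding brownian_motion_def X_def by auto
  then have "indep_var borel h borel X"
  proof (rule indep_set_imp_indep_var[rotated 2])
    show "{h -` S \<inter> space M |S. S \<in> sets borel} \<subseteq> sets (F s)"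
      using measurable_sets[OF h(1)] space_F[OF st(1)] by auto
  qed (use h X in \<open>auto simp: sq_integrable_def\<close>)
  then have "expectation (\<lambda>\<omega>. h \<omega> * X \<omega>) = expectation h * expectation X"
    using h X by (intro indep_var_lebesgue_integral) (auto intro: sq_integrable_integrable)
  moreover have "expectation X = 0"
    unfolding X_def using st' W_sq by (simp add: sq_integrable_integrable W_moments)
  moreover have "expectation (\<lambda>\<omega>. h \<omega> * X \<omega>) = expectation (\<lambda>\<omega>. W t \<omega> * h \<omega> - W s \<omega> * h \<omega>)"
    by (intro Bochner_Integration.integral_cong) (auto simp: X_def algebra_simps)
  ultimately show ?thesis
    using sq_integrable_mult_integrable[OF W_sq h(2)] st' by simp
qed simp

text \<open>The martingale property started at time \<open>0\<close>, where \<open>W\<close>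
  vanishes almost surely.\<close>

lemma W_orthogonal_F0:
  assumes t: "t \<in> {0..T}" and h: "h \<in> borel_measurable (F 0)" "sq_integrable M h"
  shows "expectation (\<lambda>\<omega>. W t \<omega> * h \<omega>) = 0"
proof -
  have "AE \<omega> in M. W 0 \<omega> = 0"
    using brownian by (simp add: brownian_motion_def)
  then have "expectation (\<lambda>\<omega>. W 0 \<omega> * h \<omega>) = expectation (\<lambda>_. 0)"
    using h W_measurable_M[of 0] T_pos
    by (intro integral_cong_AE) (auto simp: sq_integrable_def intro!: borel_measurable_times)
  then show ?thesis
    using martingale_increment[of 0 t h] t h T_pos by simp
qed

lemma indep_of_data_expectation:
  assumes Z: "indep_of_data M T W \<xi> borel Z" and "sq_integrable M Z"
  shows "expectation (\<lambda>\<omega>. Z \<omega> * \<xi> \<omega>) = expectation Z * expectation \<xi>"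
proof (rule indep_var_lebesgue_integral)
  have *: "Z \<in> borel_measurable M"
    "(\<lambda>\<omega>. (\<xi> \<omega>, trajectory T W \<omega>)) \<in> measurable M (borel \<Otimes>\<^sub>M trajectory_space T)"
    "indep_set {Z -` A \<inter> space M | A. A \<in> sets borel}
      {(\<lambda>\<omega>. (\<xi> \<omega>, trajectory T W \<omega>)) -` B \<inter> space M | B. B \<in> sets (borel \<Otimes>\<^sub>M trajectory_space T)}"
    using Z by (simp_all add: indep_of_data_def indep_rv_def)
  show "indep_var borel Z borel \<xi>"
  proof (rule indep_set_imp_indep_var[OF *(1) xi_measurable_M *(3)])
    show "{\<xi> -` S \<inter> space M |S. S \<in> sets borel} \<subseteq>
        {(\<lambda>\<omega>. (\<xi> \<omega>, trajectory T W \<omega>)) -` B \<inter> space M | B. B \<in> sets (borel \<Otimes>\<^sub>M trajectory_space T)}"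
    proof safe
      fix S :: "real set" assume "S \<in> sets borel"
      moreover have "trajectory T W \<omega> \<in> space (trajectory_space T)" if "\<omega> \<in> space M" for \<omega>
        using measurable_space[OF *(2) that] by (simp add: space_pair_measure)
      \<comment> \<open>An event of \<open>\<xi>\<close> alone is a cylinder for the pair: its
        second factor is the whole trajectory space.\<close>
      ultimately show "\<exists>B. \<xi> -` S \<inter> space M =
          (\<lambda>\<omega>. (\<xi> \<omega>, trajectory T W \<omega>)) -` B \<inter> space M \<and> B \<in> sets (borel \<Otimes>\<^sub>M trajectory_space T)"
        by (intro exI[of _ "S \<times> space (trajectory_space T)"]) auto
    qed
  qed auto
qed (use assms xi_sq in \<open>auto intro: sq_integrable_integrable\<close>)

section \<open>Admissible controls\<close>

lemma progressive_measurable: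
  assumes "progressively_measurable T G \<alpha>" "t \<in> {0..T}"
  shows "(\<lambda>p. \<alpha> (fst p) (snd p)) \<in> borel_measurable (time_measure t \<Otimes>\<^sub>M G t)"
  using assms by (simp add: progressively_measurable_def measurable_time_pair case_prod_beta')

lemma measurable_Q_subalgebra:
  assumes f: "f \<in> borel_measurable (time_measure T \<Otimes>\<^sub>M G)" and G: "subalgebra M G"
  shows "f \<in> borel_measurable Q"
proof -
  have [measurable]: "(\<lambda>x. x) \<in> measurable M G"
    using G by (intro measurableI) (auto simp: subalgebra_def)
  have "(\<lambda>p. (fst p, snd p)) \<in> measurable Q (time_measure T \<Otimes>\<^sub>M G)"
    using measurable_compose[OF measurable_snd \<open>(\<lambda>x. x) \<in> measurable M G\<close>] by measurable
  from measurable_compose[OF this f] show ?thesis by simp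
qed

text \<open>Progressive measurability at the final time gives joint measurability, and Tonelli then
  turns the iterated integral of the definition into one over the product space. From here on
  admissible controls are handled as elements of a single space of square integrable
  functions.\<close>

lemma H2_iff:
  assumes "subalgebra M (G T)"
  shows "\<alpha> \<in> H2 M T G \<longleftrightarrow> progressively_measurable T G \<alpha> \<and> sq_process \<alpha>"
proof (cases "progressively_measurable T G \<alpha>")
  case True
  have m [measurable]: "(\<lambda>p. \<alpha> (fst p) (snd p)) \<in> borel_measurable Q"
    using measurable_Q_subalgebra[OF progressive_measurable[OF True, of T] assms] T_pos by simp
  have m2: "(\<lambda>p. (\<alpha> (fst p) (snd p))\<^sup>2) \<in> borel_measurable Q"
    by measurable
  have "(\<integral>\<^sup>+\<omega>. (\<integral>\<^sup>+t\<in>{0..T}. ennreal ((\<alpha> t \<omega>)\<^sup>2) \<partial>lborel) \<partial>M) =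
      (\<integral>\<^sup>+\<omega>. (\<integral>\<^sup>+t. ennreal ((\<alpha> (fst (t, \<omega>)) (snd (t, \<omega>)))\<^sup>2) \<partial>time_measure T) \<partial>M)"
    by (subst nn_integral_restrict_space) (auto intro!: nn_integral_cong)
  also have "\<dots> = (\<integral>\<^sup>+p. ennreal ((\<alpha> (fst p) (snd p))\<^sup>2) \<partial>Q)"
    by (intro LM.nn_integral_snd) measurable
  finally have *: "(\<integral>\<^sup>+\<omega>. (\<integral>\<^sup>+t\<in>{0..T}. ennreal ((\<alpha> t \<omega>)\<^sup>2) \<partial>lborel) \<partial>M) =
      (\<integral>\<^sup>+p. ennreal (norm ((\<alpha> (fst p) (snd p))\<^sup>2)) \<partial>Q)" by simp
  show ?thesis
    unfolding H2_def sq_integrable_def integrable_iff_bounded mem_Collect_eq *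
    by (simp only: True m m2 simp_thms)
qed (simp add: H2_def)

lemma H2_sq_process: "\<alpha> \<in> H2 M T F \<Longrightarrow> sq_process \<alpha>"
  using H2_iff[of F] F_subalgebra[of T] T_pos by simp

section \<open>The filtration generated by initial value and noise, inside the given one\<close>

lemma space_raw: "space (raw_filtration M W \<xi> t) = space M"
  by (simp add: raw_filtration_def space_measure_of_conv)

lemma sets_raw:
  "sets (raw_filtration M W \<xi> t) = sigma_sets (space M)
     ({\<xi> -` A \<inter> space M | A. A \<in> sets borel} \<union>
      {W s -` A \<inter> space M | s A. s \<in> {0..t} \<and> A \<in> sets borel} \<union> null_sets M)"
  unfolding raw_filtration_def
proof (rule sets_measure_of)
  show "{\<xi> -` A \<inter> space M | A. A \<in> sets borel} \<union>
      {W s -` A \<inter> space M | s A. s \<in> {0..t} \<and> A \<in> sets borel} \<union> null_sets M \<subseteq> Pow (space M)"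
    using sets.sets_into_space[OF null_setsD2] by blast
qed

lemma raw_subset_F:
  assumes t: "t \<in> {0..T}"
  shows "sets (raw_filtration M W \<xi> t) \<subseteq> sets (F t)"
  unfolding sets_raw space_F[OF t, symmetric]
proof (intro sets.sigma_sets_subset Un_least)
  have "\<xi> \<in> borel_measurable (F t)"
    using F_measurable_mono[OF xi_measurable] t by simp
  from measurable_sets[OF this] show "{\<xi> -` A \<inter> space (F t) |A. A \<in> sets borel} \<subseteq> sets (F t)"
    by auto
  have "W s \<in> borel_measurable (F t)" if "s \<in> {0..t}" for s
    using F_measurable_mono[OF W_adapted[of s]] that t by simp
  from measurable_sets[OF this]
  show "{W s -` A \<inter> space (F t) |s A. s \<in> {0..t} \<and> A \<in> sets borel} \<subseteq> sets (F t)"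
    by auto
  have "\<forall>N\<in>null_sets M. \<forall>A. A \<subseteq> N \<longrightarrow> A \<in> sets (F 0)"
    using usual by (simp add: usual_filtration_def)
  then have "null_sets M \<subseteq> sets (F 0)" by blast
  also have "\<dots> \<subseteq> sets (F t)"
    using F_mono[of 0 t] t by simp
  finally show "null_sets M \<subseteq> sets (F t)" .
qed

lemma space_F1: "space (F\<^sub>1 t) = space M"
  by (simp add: generated_filtration_def space_measure_of_conv)

text \<open>Right-continuity of \<open>F\<close> absorbs the intersection over later times in the
  generated filtration; at the final time the raw \<sigma>-algebras are compared directly.\<close>

lemma F1_subset_F:
  assumes t: "t \<in> {0..T}"
  shows "sets (F\<^sub>1 t) \<subseteq> sets (F t)"
proof -
  define A where "A = (if t < T then \<Inter>s\<in>{t<..T}. sets (raw_filtration M W \<xi> s)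
      else sets (raw_filtration M W \<xi> T))"
  have A: "A \<subseteq> sets (F t)"
  proof (cases "t < T")
    case True
    have "\<forall>t\<in>{0..<T}. sets (F t) = (\<Inter>s\<in>{t<..T}. sets (F s))"
      using usual by (simp add: usual_filtration_def)
    moreover have "t \<in> {0..<T}" using True t by simp
    ultimately have "sets (F t) = (\<Inter>s\<in>{t<..T}. sets (F s))" by (rule bspec)
    moreover have "(\<Inter>s\<in>{t<..T}. sets (raw_filtration M W \<xi> s)) \<subseteq> (\<Inter>s\<in>{t<..T}. sets (F s))"
      using t by (intro INF_superset_mono raw_subset_F) auto
    ultimately show ?thesis
      unfolding A_def using True by simp
  next
    case False
    then have "t = T" using t by auto
    then show ?thesis using raw_subset_F[OF t] by (simp add: A_def)
  qed
  then have "A \<subseteq> Pow (space M)"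
    using sets.sets_into_space[of _ "F t"] space_F[OF t] by auto
  then have "sets (F\<^sub>1 t) = sigma_sets (space (F t)) A"
    unfolding generated_filtration_def A_def[symmetric] using space_F[OF t] by simp
  then show ?thesis
    using sets.sigma_sets_subset[OF A] by simp
qed

lemma F1_subalgebra: "t \<in> {0..T} \<Longrightarrow> subalgebra (F t) (F\<^sub>1 t)"
  using F1_subset_F space_F1 space_F by (simp add: subalgebra_def)

text \<open>The raw \<sigma>-algebras increase with time, so an event known at time \<open>t\<close>
  belongs to every later one and hence to their intersection.\<close>

lemma F1_measurable:
  fixes f :: "'a \<Rightarrow> real"
  assumes t: "t \<in> {0..T}"
    and f: "\<And>A. A \<in> sets borel \<Longrightarrow> f -` A \<inter> space M \<in> sets (raw_filtration M W \<xi> t)"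
  shows "f \<in> borel_measurable (F\<^sub>1 t)"
proof (rule measurableI)
  fix A :: "real set" assume A: "A \<in> sets borel"
  have mono: "sets (raw_filtration M W \<xi> s) \<subseteq> sets (raw_filtration M W \<xi> s')" if "s \<le> s'" for s s'
    unfolding sets_raw using that by (intro sigma_sets_mono' Un_mono order_refl) fastforce
  define B where "B = (if t < T then \<Inter>s\<in>{t<..T}. sets (raw_filtration M W \<xi> s)
      else sets (raw_filtration M W \<xi> T))"
  have "B \<subseteq> sets (raw_filtration M W \<xi> T)"
    using t by (auto simp: B_def)
  then have "B \<subseteq> Pow (space M)"
    using sets.sets_into_space[of _ "raw_filtration M W \<xi> T"] space_raw[of T] by auto
  moreover have "f -` A \<inter> space M \<in> B"
    using subsetD[OF mono f[OF A]] t by (auto simp: B_def)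
  ultimately show "f -` A \<inter> space (F\<^sub>1 t) \<in> sets (F\<^sub>1 t)"
    unfolding space_F1 unfolding generated_filtration_def B_def[symmetric] by auto
qed simp

lemma W_F1_measurable:
  assumes "t \<in> {0..T}" "s \<in> {0..t}"
  shows "W s \<in> borel_measurable (F\<^sub>1 t)"
  using assms unfolding sets_raw by (intro F1_measurable[unfolded sets_raw] sigma_sets.Basic) auto

lemma xi_F1_measurable: "t \<in> {0..T} \<Longrightarrow> \<xi> \<in> borel_measurable (F\<^sub>1 t)"
  by (intro F1_measurable[unfolded sets_raw] sigma_sets.Basic) auto

lemma F1_subalgebra_M: "t \<in> {0..T} \<Longrightarrow> subalgebra M (F\<^sub>1 t)"
  using F1_subalgebra F_subalgebra by (fastforce simp: subalgebra_def)

text \<open>Optimality is tested on controls of the small filtration, whereas the martingale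
  property of \<open>W\<close> is stated for the large one.\<close>

lemma H2_F1_subset: "H2 M T F\<^sub>1 \<subseteq> H2 M T F"
proof
  fix \<alpha> assume \<alpha>: "\<alpha> \<in> H2 M T F\<^sub>1"
  have T: "T \<in> {0..T}" using T_pos by simp
  have "progressively_measurable T F \<alpha>"
    unfolding progressively_measurable_def
  proof
    fix t assume t: "t \<in> {0..T}"
    have id: "(\<lambda>x. x) \<in> measurable (F t) (F\<^sub>1 t)"
      using F1_subalgebra[OF t] by (intro measurableI) (auto simp: subalgebra_def)
    have "(\<lambda>p. (fst p, snd p)) \<in> measurable (time_measure t \<Otimes>\<^sub>M F t) (time_measure t \<Otimes>\<^sub>M F\<^sub>1 t)"
      using measurable_compose[OF measurable_snd id] by measurable
    moreover have "(\<lambda>p. \<alpha> (fst p) (snd p)) \<in> borel_measurable (time_measure t \<Otimes>\<^sub>M F\<^sub>1 t)"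
      using \<alpha> t by (intro progressive_measurable) (auto simp: H2_def)
    ultimately have "(\<lambda>p. \<alpha> (fst (fst p, snd p)) (snd (fst p, snd p))) \<in> borel_measurable (time_measure t \<Otimes>\<^sub>M F t)"
      by (rule measurable_compose)
    then show "(\<lambda>(s, \<omega>). \<alpha> s \<omega>) \<in> borel_measurable (restrict_space borel {0..t} \<Otimes>\<^sub>M F t)"
      by (simp add: measurable_time_pair case_prod_beta')
  qed
  moreover have "sq_process \<alpha>"
    using \<alpha> H2_iff[of F\<^sub>1] F1_subalgebra_M[OF T] by simp
  ultimately show "\<alpha> \<in> H2 M T F"
    using H2_iff[of F] F_subalgebra[OF T] by simp
qed

section \<open>The linear state equation\<close>

lemma phi_deriv: "t \<in> {0..T} \<Longrightarrow> (\<phi> has_real_derivative (\<phi> t)\<^sup>2 - \<epsilon>) (at t within {0..T})"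
proof -
  assume "t \<in> {0..T}"
  from phi_ode[OF this] obtain D where "(\<phi> has_real_derivative D) (at t within {0..T})" "D + \<epsilon> - (\<phi> t)\<^sup>2 = 0"
    by auto
  moreover from this(2) have "D = (\<phi> t)\<^sup>2 - \<epsilon>" by simp
  ultimately show ?thesis by simp
qed

lemma phi_cont: "continuous_on {0..T} \<phi>"
  by (rule continuous_on_has_derivative[OF phi_deriv])

text \<open>The exponent of the integrating factor for the linear equation with rate
  \<open>\<phi>\<close>.\<close>

definition \<Phi> :: "real \<Rightarrow> real" where
  "\<Phi> t = (LBINT s:{0..t}. \<phi> s)"

lemma Phi_deriv: "t \<in> {0..T} \<Longrightarrow> (\<Phi> has_real_derivative \<phi> t) (at t within {0..T})"
  unfolding \<Phi>_def by (rule primitive_has_derivative[OF phi_cont])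

lemma Phi_cont: "continuous_on {0..T} \<Phi>"
  by (rule continuous_on_has_derivative[OF Phi_deriv])

text \<open>
  Variation of constants is applied to \<open>R = Y - W\<close>, which has continuously differentiable paths,
  so no stochastic integral is needed.
\<close>

definition R :: "real \<Rightarrow> 'a \<Rightarrow> real" where
  "R t \<omega> = exp (- \<Phi> t) * (\<xi> \<omega> - expectation \<xi> - (LBINT s:{0..t}. (\<phi> s * exp (\<Phi> s)) * W s \<omega>))"

definition Y :: "real \<Rightarrow> 'a \<Rightarrow> real" where
  "Y t \<omega> = R t \<omega> + W t \<omega>"

lemma kernel_cont: "\<omega> \<in> space M \<Longrightarrow> continuous_on {0..T} (\<lambda>s. (\<phi> s * exp (\<Phi> s)) * W s \<omega>)"
  by (intro continuous_intros phi_cont Phi_cont W_continuous)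

lemma set_integral_singleton: "(LBINT s:{0..0}. f s :: real) = 0" for f :: "real \<Rightarrow> real"
  unfolding set_lebesgue_integral_def
  by (intro integral_eq_zero_AE AE_I[of _ _ "{0}"]) (auto simp: indicator_def)

text \<open>Differentiating the factor \<open>exp (- \<Phi> t)\<close> reproduces
  \<open>- \<phi> t * R t \<omega>\<close>, while in the kernel term the exponentials cancel and
  leave \<open>- \<phi> t * W t \<omega>\<close>.\<close>

lemma R_deriv:
  assumes \<omega>: "\<omega> \<in> space M" and t: "t \<in> {0..T}"
  shows "((\<lambda>t. R t \<omega>) has_real_derivative - \<phi> t * Y t \<omega>) (at t within {0..T})"
proof -
  let ?K = "\<lambda>t. LBINT s:{0..t}. (\<phi> s * exp (\<Phi> s)) * W s \<omega>"
  have "((\<lambda>t. exp (- \<Phi> t) * (\<xi> \<omega> - expectation \<xi> - ?K t)) has_real_derivative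
      exp (- \<Phi> t) * (- \<phi> t) * (\<xi> \<omega> - expectation \<xi> - ?K t)
        + exp (- \<Phi> t) * - ((\<phi> t * exp (\<Phi> t)) * W t \<omega>)) (at t within {0..T})"
    by (rule derivative_eq_intros Phi_deriv primitive_has_derivative[OF kernel_cont] \<omega> t refl)+
      (simp add: algebra_simps)
  moreover have "exp (- \<Phi> t) * exp (\<Phi> t) = 1"
    by (simp add: exp_minus)
  then have "exp (- \<Phi> t) * (- \<phi> t) * (\<xi> \<omega> - expectation \<xi> - ?K t)
        + exp (- \<Phi> t) * - ((\<phi> t * exp (\<Phi> t)) * W t \<omega>) = - \<phi> t * Y t \<omega>"
    unfolding Y_def R_def by algebra
  ultimately show ?thesis unfolding R_def by simp
qed

lemma R_cont: "\<omega> \<in> space M \<Longrightarrow> continuous_on {0..T} (\<lambda>t. R t \<omega>)"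
  by (rule continuous_on_has_derivative[OF R_deriv])

lemma Y_cont: "\<omega> \<in> space M \<Longrightarrow> continuous_on {0..T} (\<lambda>t. Y t \<omega>)"
  unfolding Y_def by (intro continuous_intros R_cont W_continuous)

lemma R_0: "R 0 \<omega> = \<xi> \<omega> - expectation \<xi>"
  using set_integral_singleton by (simp add: R_def \<Phi>_def)

lemma R_eq:
  assumes \<omega>: "\<omega> \<in> space M" and t: "t \<in> {0..T}"
  shows "(LBINT s:{0..t}. - \<phi> s * Y s \<omega>) = R t \<omega> - R 0 \<omega>"
proof (rule set_integral_derivative)
  have sub: "{0..t} \<subseteq> {0..T}" using t by auto
  show "continuous_on {0..t} (\<lambda>s. - \<phi> s * Y s \<omega>)"
    by (rule continuous_on_subset[OF _ sub]) (intro continuous_intros phi_cont Y_cont \<omega>)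
  show "((\<lambda>t. R t \<omega>) has_real_derivative - \<phi> s * Y s \<omega>) (at s within {0..t})" if "s \<in> {0..t}" for s
    using DERIV_subset[OF R_deriv[OF \<omega>] sub] that sub by auto
qed (use t in auto)

text \<open>The equilibrium feedback \<open>\<phi> t\<close> times the mean minus the state, written
  as an explicit process: its own state exceeds the mean of \<open>\<xi>\<close> by exactly
  \<open>Y\<close>.\<close>

abbreviation \<gamma> :: "real \<Rightarrow> 'a \<Rightarrow> real" where
  "\<gamma> \<equiv> \<lambda>t \<omega>. - \<phi> t * Y t \<omega>"

lemma state_gamma:
  assumes "\<omega> \<in> space M" "t \<in> {0..T}"
  shows "state W \<xi> \<gamma> t \<omega> = expectation \<xi> + Y t \<omega>"
  unfolding state_def R_eq[OF assms] R_0 by (simp add: Y_def)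

lemma R_sq_process: "sq_process R"
proof -
  have "sq_process (\<lambda>t \<omega>. (\<phi> t * exp (\<Phi> t)) * W t \<omega>)"
    by (intro sq_process_cont_mult W_sq_process continuous_intros phi_cont Phi_cont)
  then have "sq_process (\<lambda>t \<omega>. \<xi> \<omega> - expectation \<xi> - (LBINT s:{0..t}. (\<phi> s * exp (\<Phi> s)) * W s \<omega>))"
    by (intro sq_integrable_diff sq_process_primitive sq_integrable_Q_snd xi_sq Q.sq_integrable_const)
  then show ?thesis
    unfolding R_def by (intro sq_process_cont_mult continuous_intros Phi_cont)
qed

lemma Y_sq_process: "sq_process Y"
  unfolding Y_def by (intro sq_integrable_add R_sq_process W_sq_process)

lemma gamma_sq_process: "sq_process \<gamma>"
  by (intro sq_process_cont_mult Y_sq_process continuous_intros phi_cont)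

text \<open>Up to time \<open>t\<close>, \<open>Y\<close> is assembled from \<open>\<xi>\<close>,
  deterministic functions and the path of \<open>W\<close> up to \<open>t\<close>.\<close>

lemma gamma_progressive: "progressively_measurable T F\<^sub>1 \<gamma>"
  unfolding progressively_measurable_def
proof
  fix t assume t: "t \<in> {0..T}"
  have sub: "{0..t} \<subseteq> {0..T}" using t by auto
  have [measurable]: "\<phi> \<in> borel_measurable (time_measure t)" "\<Phi> \<in> borel_measurable (time_measure t)"
    by (auto intro: continuous_on_measurable_time continuous_on_subset[OF _ sub] phi_cont Phi_cont)
  have [measurable]: "\<xi> \<in> borel_measurable (F\<^sub>1 t)" by (rule xi_F1_measurable[OF t])
  have W [measurable]: "(\<lambda>p. W (fst p) (snd p)) \<in> borel_measurable (time_measure t \<Otimes>\<^sub>M F\<^sub>1 t)"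
    using t by (intro continuous_process_measurable W_F1_measurable)
      (auto simp: space_F1 intro: continuous_on_subset[OF W_continuous sub])
  have "(\<lambda>p. (\<phi> (fst p) * exp (\<Phi> (fst p))) * W (fst p) (snd p))
      \<in> borel_measurable (time_measure t \<Otimes>\<^sub>M F\<^sub>1 t)"
    by measurable
  note primitive_measurable[OF this, measurable]
  have "(\<lambda>p. - \<phi> (fst p) * Y (fst p) (snd p)) \<in> borel_measurable (time_measure t \<Otimes>\<^sub>M F\<^sub>1 t)"
    unfolding Y_def R_def by measurable
  then show "(\<lambda>(s, \<omega>). \<gamma> s \<omega>) \<in> borel_measurable (restrict_space borel {0..t} \<Otimes>\<^sub>M F\<^sub>1 t)"
    by (simp add: measurable_time_pair case_prod_beta')
qed

lemma gamma_H2: "\<gamma> \<in> H2 M T F\<^sub>1"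
  using H2_iff[of F\<^sub>1] F1_subalgebra_M[of T] gamma_progressive gamma_sq_process T_pos by simp

text \<open>Continuity of \<open>E\<close> makes the right-hand side of the integral equation
  differentiable, hence also \<open>E\<close>. Then \<open>exp (\<Phi> s) * E s\<close> has
  derivative zero and vanishes at \<open>0\<close>.\<close>

lemma linear_ode_unique:
  assumes E: "continuous_on {0..T} E" and eq: "\<And>t. t \<in> {0..T} \<Longrightarrow> E t = (LBINT s:{0..t}. - \<phi> s * E s)"
    and t: "t \<in> {0..T}"
  shows "E t = 0"
proof -
  have c: "continuous_on {0..T} (\<lambda>s. - \<phi> s * E s)"
    by (intro continuous_intros phi_cont E)
  have d: "(E has_real_derivative - \<phi> s * E s) (at s within {0..T})" if "s \<in> {0..T}" for s
    by (rule has_field_derivative_transform_within[OF primitive_has_derivative[OF c that] zero_less_one that])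
      (rule eq[symmetric])
  have "((\<lambda>s. exp (\<Phi> s) * E s) has_real_derivative 0) (at s within {0..T})" if s: "s \<in> {0..T}" for s
    by (rule derivative_eq_intros Phi_deriv d s refl)+ (simp add: algebra_simps)
  then obtain c where "\<forall>s\<in>{0..T}. exp (\<Phi> s) * E s = c"
    using has_field_derivative_zero_constant[of "{0..T}" "\<lambda>s. exp (\<Phi> s) * E s"] by auto
  then have "exp (\<Phi> t) * E t = exp (\<Phi> 0) * E 0"
    using t T_pos by simp
  moreover have "E 0 = 0"
    using trans[OF eq[of 0] set_integral_singleton] T_pos by simp
  ultimately show ?thesis by simp
qed

section \<open>The first-order condition\<close>

lemma L_sq_cont: "continuous_on {0..T} g \<Longrightarrow> sq_integrable (time_measure T) g"
  by (auto simp: sq_integrable_def intro!: continuous_on_measurable_time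
      continuous_on_integrable_time continuous_intros)

lemma L_sq_cont_mult:
  assumes "continuous_on {0..T} g" "sq_integrable (time_measure T) f"
  shows "integrable (time_measure T) (\<lambda>t. g t * f t)"
  by (intro sq_integrable_mult_integrable L_sq_cont assms)

text \<open>Progressive measurability controls the process jointly on \<open>{0..t}\<close>, which
  is what the primitive up to \<open>t\<close> requires.\<close>

lemma H2_adapted:
  assumes \<delta>: "\<delta> \<in> H2 M T F" and t: "t \<in> {0..T}"
  shows "\<delta> t \<in> borel_measurable (F t)" "(\<lambda>\<omega>. LBINT s:{0..t}. \<delta> s \<omega>) \<in> borel_measurable (F t)"
proof -
  have m: "(\<lambda>p. \<delta> (fst p) (snd p)) \<in> borel_measurable (time_measure t \<Otimes>\<^sub>M F t)"
    using \<delta> t by (intro progressive_measurable) (auto simp: H2_def)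
  have p: "Pair t \<in> measurable (F t) (time_measure t \<Otimes>\<^sub>M F t)"
    using t by (intro measurable_Pair1') simp
  show "\<delta> t \<in> borel_measurable (F t)"
    using measurable_compose[OF p m] by simp
  show "(\<lambda>\<omega>. LBINT s:{0..t}. \<delta> s \<omega>) \<in> borel_measurable (F t)"
    using measurable_compose[OF p primitive_measurable[OF m]] by simp
qed

text \<open>Here \<open>h\<close> is the derivative of \<open>\<phi>\<close> times the primitive
  \<open>D\<close> of \<open>\<delta>\<close>, so its integral is a boundary term that vanishes by
  \<open>\<phi> T = 0\<close>. In the second identity the integral of \<open>\<phi> D\<close>
  against \<open>W\<close>, which remains after integrating the product \<open>\<phi> Y D\<close>,
  is traded for minus the integral of \<open>W\<close> against \<open>h\<close>.\<close>

lemma pathwise_first_order: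
  assumes \<omega>: "\<omega> \<in> space M" and \<delta>: "sq_integrable (time_measure T) (\<lambda>t. \<delta> t \<omega>)"
    and D: "sq_integrable (time_measure T) (\<lambda>t. LBINT s:{0..t}. \<delta> s \<omega>)"
  defines "h \<equiv> \<lambda>t. \<phi> t * \<delta> t \<omega> + ((\<phi> t)\<^sup>2 - \<epsilon>) * (LBINT s:{0..t}. \<delta> s \<omega>)"
  shows "(\<integral>t. h t \<partial>time_measure T) = 0"
    and "(\<integral>t. \<gamma> t \<omega> * \<delta> t \<omega> + \<epsilon> * (Y t \<omega> * (LBINT s:{0..t}. \<delta> s \<omega>)) \<partial>time_measure T)
      = - (\<integral>t. W t \<omega> * h t \<partial>time_measure T)"
proof -
  let ?L = "time_measure T"
  define d where "d t = (LBINT s:{0..t}. \<delta> s \<omega>)" for t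
  have int_\<delta>: "integrable ?L (\<lambda>t. \<delta> t \<omega>)" by (rule L.sq_integrable_integrable[OF \<delta>])
  note D' = D[folded d_def]
  have c2: "continuous_on {0..T} (\<lambda>t. (\<phi> t)\<^sup>2 - \<epsilon>)" by (intro continuous_intros phi_cont)
  have T0: "0 \<le> T" using T_pos by simp
  have "(\<integral>t. \<phi> t * \<delta> t \<omega> \<partial>?L) = - (\<integral>t. ((\<phi> t)\<^sup>2 - \<epsilon>) * d t \<partial>?L)"
    unfolding d_def by (rule integral_by_parts_primitive[OF T0 int_\<delta> c2 phi_deriv phi_terminal])
  then show "(\<integral>t. h t \<partial>?L) = 0"
    unfolding h_def d_def[symmetric]
    by (subst Bochner_Integration.integral_add) (auto intro!: L_sq_cont_mult phi_cont c2 \<delta> D')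
  \<comment> \<open>\<open>g\<close> is the derivative of \<open>\<phi> t * R t \<omega>\<close>;
    the smooth part of \<open>Y\<close> admits integration by parts against \<open>\<delta>\<close>
    on each path.\<close>
  define g where "g t = ((\<phi> t)\<^sup>2 - \<epsilon>) * R t \<omega> + \<phi> t * (- \<phi> t * Y t \<omega>)" for t
  have g: "continuous_on {0..T} g"
    unfolding g_def by (intro continuous_intros phi_cont R_cont Y_cont \<omega>)
  have "((\<lambda>t. \<phi> t * R t \<omega>) has_real_derivative g t) (at t within {0..T})" if "t \<in> {0..T}" for t
    unfolding g_def by (rule derivative_eq_intros phi_deriv R_deriv \<omega> that refl)+ simp
  then have ibp: "(\<integral>t. (\<phi> t * R t \<omega>) * \<delta> t \<omega> \<partial>?L) = - (\<integral>t. g t * d t \<partial>?L)"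
    unfolding d_def using phi_terminal by (intro integral_by_parts_primitive[OF T0 int_\<delta> g]) auto
  have h: "sq_integrable ?L h"
    unfolding h_def d_def[symmetric]
  proof (intro sq_integrable_add)
    obtain C where "\<forall>t\<in>{0..T}. \<bar>\<phi> t\<bar> \<le> C"
      using compact_imp_bounded[OF compact_continuous_image[OF phi_cont compact_Icc]]
      unfolding bounded_iff by auto
    then show "sq_integrable ?L (\<lambda>t. \<phi> t * \<delta> t \<omega>)"
      by (intro sq_integrable_bounded_mult[OF \<delta>] continuous_on_measurable_time phi_cont) auto
    obtain C where "\<forall>t\<in>{0..T}. \<bar>(\<phi> t)\<^sup>2 - \<epsilon>\<bar> \<le> C"
      using compact_imp_bounded[OF compact_continuous_image[OF c2 compact_Icc]]
      unfolding bounded_iff by auto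
    then show "sq_integrable ?L (\<lambda>t. ((\<phi> t)\<^sup>2 - \<epsilon>) * d t)"
      by (intro sq_integrable_bounded_mult[OF D'] continuous_on_measurable_time c2) auto
  qed
  have i: "integrable ?L (\<lambda>t. W t \<omega> * h t)" "integrable ?L (\<lambda>t. (\<phi> t * R t \<omega>) * \<delta> t \<omega>)"
    "integrable ?L (\<lambda>t. g t * d t)"
    by (intro L_sq_cont_mult W_continuous continuous_intros phi_cont R_cont \<omega> h \<delta> g D')+
  \<comment> \<open>With \<open>Y = R + W\<close> the two \<open>\<phi>\<^sup>2\<close> terms cancel
    and only \<open>\<epsilon>\<close> times \<open>Y\<close> times the primitive survives. The
    second bracket on the right has integral zero by \<open>ibp\<close>.\<close>
  have "(\<integral>t. \<gamma> t \<omega> * \<delta> t \<omega> + \<epsilon> * (Y t \<omega> * d t) \<partial>?L)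
      = (\<integral>t. - (W t \<omega> * h t) - ((\<phi> t * R t \<omega>) * \<delta> t \<omega> + g t * d t) \<partial>?L)"
    by (intro Bochner_Integration.integral_cong refl)
      (simp add: h_def d_def[symmetric] g_def Y_def algebra_simps power2_eq_square)
  also have "\<dots> = - (\<integral>t. W t \<omega> * h t \<partial>?L)"
    using i ibp by simp
  finally show "(\<integral>t. \<gamma> t \<omega> * \<delta> t \<omega> + \<epsilon> * (Y t \<omega> * (LBINT s:{0..t}. \<delta> s \<omega>)) \<partial>?L)
      = - (\<integral>t. W t \<omega> * h t \<partial>?L)"
    unfolding d_def .
qed

text \<open>
  Since \<open>E[W\<^sub>t h\<^sub>t] = E[W\<^sub>T h\<^sub>t]\<close> for adapted \<open>h\<close>, we have \<open>E \<integral> W h dt = E[W\<^sub>T \<integral> h dt] = 0\<close>: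
  this replaces the vanishing expectation of a stochastic integral.
\<close>

lemma first_order_condition:
  assumes \<delta>: "\<delta> \<in> H2 M T F"
  shows "(\<integral>p. \<gamma> (fst p) (snd p) * \<delta> (fst p) (snd p)
      + \<epsilon> * (Y (fst p) (snd p) * (LBINT s:{0..fst p}. \<delta> s (snd p))) \<partial>Q) = 0"
proof -
  define D where "D = (\<lambda>t \<omega>. LBINT s:{0..t}. \<delta> s \<omega>)"
  define h where "h = (\<lambda>t \<omega>. \<phi> t * \<delta> t \<omega> + ((\<phi> t)\<^sup>2 - \<epsilon>) * D t \<omega>)"
  define u where "u = (\<lambda>t \<omega>. \<gamma> t \<omega> * \<delta> t \<omega> + \<epsilon> * (Y t \<omega> * D t \<omega>))"
  have \<delta>_sq: "sq_process \<delta>" by (rule H2_sq_process[OF \<delta>])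
  have D_sq: "sq_process D" unfolding D_def by (rule sq_process_primitive[OF \<delta>_sq])
  have h_sq: "sq_process h"
    unfolding h_def by (intro sq_integrable_add sq_process_cont_mult \<delta>_sq D_sq continuous_intros phi_cont)
  have WT_sq: "sq_process (\<lambda>t \<omega>. W T \<omega>)"
    using T_pos by (intro sq_integrable_Q_snd W_sq) simp
  have int_u: "integrable Q (\<lambda>p. u (fst p) (snd p))"
    unfolding u_def by (intro Bochner_Integration.integrable_add integrable_mult_right
      sq_integrable_mult_integrable gamma_sq_process \<delta>_sq Y_sq_process D_sq)
  have int_Wh: "integrable Q (\<lambda>p. W (fst p) (snd p) * h (fst p) (snd p))"
    by (intro sq_integrable_mult_integrable W_sq_process h_sq)
  have int_WTh: "integrable Q (\<lambda>p. W T (snd p) * h (fst p) (snd p))"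
    by (intro sq_integrable_mult_integrable WT_sq h_sq)
  have path: "AE \<omega> in M. (\<integral>t. h t \<omega> \<partial>time_measure T) = 0 \<and>
      (\<integral>t. u t \<omega> \<partial>time_measure T) = - (\<integral>t. W t \<omega> * h t \<omega> \<partial>time_measure T)"
    using AE_space sq_process_section_sample[OF \<delta>_sq] sq_process_section_sample[OF D_sq]
  proof eventually_elim
    case (elim \<omega>)
    from pathwise_first_order[where \<delta> = \<delta> and \<omega> = \<omega>, OF elim[unfolded D_def]] show ?case
      by (simp add: h_def u_def D_def)
  qed
  have "(\<integral>p. u (fst p) (snd p) \<partial>Q) = expectation (\<lambda>\<omega>. \<integral>t. u t \<omega> \<partial>time_measure T)"
    by (rule integral_Q_sample[OF int_u])
  also have "\<dots> = expectation (\<lambda>\<omega>. - (\<integral>t. W t \<omega> * h t \<omega> \<partial>time_measure T))"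
  proof (rule integral_cong_AE)
    show "AE \<omega> in M. (\<integral>t. u t \<omega> \<partial>time_measure T) = - (\<integral>t. W t \<omega> * h t \<omega> \<partial>time_measure T)"
      using path by eventually_elim simp
  qed (use integrable_sample[OF int_u] integrable_sample[OF int_Wh] in auto)
  also have "\<dots> = - (\<integral>p. W (fst p) (snd p) * h (fst p) (snd p) \<partial>Q)"
    by (simp add: integral_Q_sample[OF int_Wh])
  also have "(\<integral>p. W (fst p) (snd p) * h (fst p) (snd p) \<partial>Q)
      = (\<integral>t. expectation (\<lambda>\<omega>. W t \<omega> * h t \<omega>) \<partial>time_measure T)"
    by (rule integral_Q_time[OF int_Wh])
  also have "\<dots> = (\<integral>t. expectation (\<lambda>\<omega>. W T \<omega> * h t \<omega>) \<partial>time_measure T)"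
  proof (rule integral_cong_AE)
    show "AE t in time_measure T. expectation (\<lambda>\<omega>. W t \<omega> * h t \<omega>) = expectation (\<lambda>\<omega>. W T \<omega> * h t \<omega>)"
      using AE_space sq_process_section_time[OF h_sq]
    proof eventually_elim
      case (elim t)
      then have t: "t \<in> {0..T}" by simp
      have "h t \<in> borel_measurable (F t)"
        unfolding h_def D_def using H2_adapted[OF \<delta> t] by simp
      then show ?case
        using martingale_increment[OF t _ _ elim(2), of T] t by simp
    qed
  qed (use integrable_time[OF int_Wh] integrable_time[OF int_WTh] in auto)
  also have "\<dots> = (\<integral>p. W T (snd p) * h (fst p) (snd p) \<partial>Q)"
    by (rule integral_Q_time[OF int_WTh, symmetric])
  also have "\<dots> = expectation (\<lambda>\<omega>. \<integral>t. W T \<omega> * h t \<omega> \<partial>time_measure T)"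
    by (rule integral_Q_sample[OF int_WTh])
  also have "\<dots> = expectation (\<lambda>\<omega>. 0)"
  proof (rule integral_cong_AE)
    show "AE \<omega> in M. (\<integral>t. W T \<omega> * h t \<omega> \<partial>time_measure T) = 0"
      using path by eventually_elim simp
  qed (use integrable_sample[OF int_WTh] in auto)
  finally show ?thesis by (simp add: u_def D_def)
qed

section \<open>The payoff functional\<close>

lemma state_sq_process:
  assumes "sq_process \<alpha>"
  shows "sq_process (state W \<xi> \<alpha>)"
  unfolding state_def
  by (intro sq_integrable_add sq_process_primitive W_sq_process sq_integrable_Q_snd xi_sq assms)

lemma running_payoff_integrable:
  assumes "sq_integrable N \<mu>" "sq_integrable N \<alpha>" "sq_integrable N x" "integrable N \<mu>"
  shows "integrable N (\<lambda>p. a * \<mu> p - b / 2 * (\<mu> p)\<^sup>2 - 1 / 2 * (\<alpha> p)\<^sup>2 - \<epsilon> / 2 * (\<mu> p - x p)\<^sup>2)"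
  by (intro Bochner_Integration.integrable_diff integrable_mult_right sq_integrable_power2
      sq_integrable_diff assms)

text \<open>Integrability over the product space lets Fubini merge the two nested integrals and
  rules out the default value \<open>0\<close> of a divergent Bochner integral.\<close>

lemma payoff_eq:
  assumes \<alpha>: "sq_process \<alpha>" and \<mu>: "sq_process \<mu>"
  shows "payoff M W \<xi> T a b \<epsilon> \<alpha> \<mu> = (\<integral>p. a * \<mu> (fst p) (snd p) - b / 2 * (\<mu> (fst p) (snd p))\<^sup>2
      - 1 / 2 * (\<alpha> (fst p) (snd p))\<^sup>2
      - \<epsilon> / 2 * (\<mu> (fst p) (snd p) - state W \<xi> \<alpha> (fst p) (snd p))\<^sup>2 \<partial>Q)"
  unfolding payoff_def set_integral_time_full
  by (rule integral_Q_sample[symmetric])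
    (intro running_payoff_integrable \<mu> \<alpha> state_sq_process Q.sq_integrable_integrable)

text \<open>The expansion is exact: the state is affine in the control and the running payoff is
  quadratic. Both the necessary condition for an equilibrium and the optimality of
  \<open>\<gamma>\<close> are read off from it.\<close>

lemma payoff_perturb:
  assumes \<alpha>: "sq_process \<alpha>" and \<delta>: "sq_process \<delta>" and \<mu>: "sq_process \<mu>"
  defines "D \<equiv> \<lambda>t \<omega>. LBINT s:{0..t}. \<delta> s \<omega>"
  shows "payoff M W \<xi> T a b \<epsilon> (\<lambda>t \<omega>. \<alpha> t \<omega> + \<delta> t \<omega>) \<mu> = payoff M W \<xi> T a b \<epsilon> \<alpha> \<mu>
      - (\<integral>p. \<alpha> (fst p) (snd p) * \<delta> (fst p) (snd p)
          + \<epsilon> * ((state W \<xi> \<alpha> (fst p) (snd p) - \<mu> (fst p) (snd p)) * D (fst p) (snd p)) \<partial>Q)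
      - (\<integral>p. 1 / 2 * (\<delta> (fst p) (snd p))\<^sup>2 + \<epsilon> / 2 * (D (fst p) (snd p))\<^sup>2 \<partial>Q)"
proof -
  define \<beta> where "\<beta> = (\<lambda>t \<omega>. \<alpha> t \<omega> + \<delta> t \<omega>)"
  define X where "X = state W \<xi> \<alpha>"
  have \<beta>: "sq_process \<beta>" unfolding \<beta>_def by (intro sq_integrable_add \<alpha> \<delta>)
  have D: "sq_process D" unfolding D_def by (rule sq_process_primitive[OF \<delta>])
  have X: "sq_process X" unfolding X_def by (rule state_sq_process[OF \<alpha>])
  \<comment> \<open>Additivity of the state holds only almost surely, because the paths of
    \<open>\<alpha>\<close> and \<open>\<delta>\<close> are known to be integrable only for almost
    every \<open>\<omega>\<close>.\<close>
  have "AE \<omega> in M. \<forall>t\<in>{0..T}. state W \<xi> \<beta> t \<omega> = X t \<omega> + D t \<omega>"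
    using sq_process_section_sample[OF \<alpha>] sq_process_section_sample[OF \<delta>]
  proof eventually_elim
    case (elim \<omega>)
    show ?case
    proof
      fix t assume "t \<in> {0..T}"
      then have "set_integrable lborel {0..t} (\<lambda>s. \<alpha> s \<omega>)" "set_integrable lborel {0..t} (\<lambda>s. \<delta> s \<omega>)"
        by (auto intro!: set_integrable_time[OF L.sq_integrable_integrable] elim)
      then show "state W \<xi> \<beta> t \<omega> = X t \<omega> + D t \<omega>"
        by (simp add: state_def X_def D_def \<beta>_def set_integral_add)
    qed
  qed
  note st = AE_Q[OF this]
  let ?u = "\<lambda>p. a * \<mu> (fst p) (snd p) - b / 2 * (\<mu> (fst p) (snd p))\<^sup>2
      - 1 / 2 * (\<alpha> (fst p) (snd p))\<^sup>2 - \<epsilon> / 2 * (\<mu> (fst p) (snd p) - X (fst p) (snd p))\<^sup>2"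
  let ?v = "\<lambda>p. \<alpha> (fst p) (snd p) * \<delta> (fst p) (snd p)
          + \<epsilon> * ((X (fst p) (snd p) - \<mu> (fst p) (snd p)) * D (fst p) (snd p))"
  let ?w = "\<lambda>p. 1 / 2 * (\<delta> (fst p) (snd p))\<^sup>2 + \<epsilon> / 2 * (D (fst p) (snd p))\<^sup>2"
  have u: "integrable Q ?u"
    by (intro running_payoff_integrable \<mu> \<alpha> X Q.sq_integrable_integrable)
  have v: "integrable Q ?v"
    by (intro Bochner_Integration.integrable_add integrable_mult_right sq_integrable_mult_integrable
      sq_integrable_diff \<mu> \<alpha> X D \<delta>)
  have w: "integrable Q ?w"
    by (intro Bochner_Integration.integrable_add integrable_mult_right sq_integrable_power2 D \<delta>)
  have split: "(\<integral>p. u p - v p - w p \<partial>Q) = (\<integral>p. u p \<partial>Q) - (\<integral>p. v p \<partial>Q) - (\<integral>p. w p \<partial>Q)"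
    if "integrable Q u" "integrable Q v" "integrable Q w" for u v w :: "real \<times> 'a \<Rightarrow> real"
    using that by simp
  have "payoff M W \<xi> T a b \<epsilon> \<beta> \<mu> = (\<integral>p. ?u p - ?v p - ?w p \<partial>Q)"
    unfolding payoff_eq[OF \<beta> \<mu>]
  proof (rule integral_cong_AE)
    show "(\<lambda>p. ?u p - ?v p - ?w p) \<in> borel_measurable Q"
      by (rule borel_measurable_integrable[OF Bochner_Integration.integrable_diff[OF
            Bochner_Integration.integrable_diff[OF u v] w]])
    show "(\<lambda>p. a * \<mu> (fst p) (snd p) - b / 2 * (\<mu> (fst p) (snd p))\<^sup>2 - 1 / 2 * (\<beta> (fst p) (snd p))\<^sup>2
        - \<epsilon> / 2 * (\<mu> (fst p) (snd p) - state W \<xi> \<beta> (fst p) (snd p))\<^sup>2) \<in> borel_measurable Q"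
      by (intro borel_measurable_integrable running_payoff_integrable \<mu> \<beta> state_sq_process
        Q.sq_integrable_integrable)
    show "AE p in Q. a * \<mu> (fst p) (snd p) - b / 2 * (\<mu> (fst p) (snd p))\<^sup>2 - 1 / 2 * (\<beta> (fst p) (snd p))\<^sup>2
        - \<epsilon> / 2 * (\<mu> (fst p) (snd p) - state W \<xi> \<beta> (fst p) (snd p))\<^sup>2 = ?u p - ?v p - ?w p"
      using st
    proof eventually_elim
      case (elim p)
      then show ?case
        unfolding elim \<beta>_def by (simp add: power2_eq_square field_simps)
    qed
  qed
  also have "\<dots> = (\<integral>p. ?u p \<partial>Q) - (\<integral>p. ?v p \<partial>Q) - (\<integral>p. ?w p \<partial>Q)"
    by (rule split[OF u v w])
  also have "(\<integral>p. ?u p \<partial>Q) = payoff M W \<xi> T a b \<epsilon> \<alpha> \<mu>"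
    unfolding payoff_eq[OF \<alpha> \<mu>] X_def ..
  finally show ?thesis unfolding \<beta>_def X_def .
qed

section \<open>The mean field equilibrium\<close>

lemma H2_F1_D:
  assumes "\<alpha> \<in> H2 M T F\<^sub>1"
  shows "progressively_measurable T F\<^sub>1 \<alpha>" "sq_process \<alpha>"
  using assms H2_iff[of F\<^sub>1] F1_subalgebra_M[of T] T_pos by auto

lemma payoff_cong:
  assumes "\<And>t. t \<in> {0..T} \<Longrightarrow> m t = m' t"
  shows "payoff M W \<xi> T a b \<epsilon> \<alpha> (\<lambda>t _. m t) = payoff M W \<xi> T a b \<epsilon> \<alpha> (\<lambda>t _. m' t)"
  unfolding payoff_def set_integral_time_full using assms
  by (auto intro!: Bochner_Integration.integral_cong)

lemma linear_le_quadratic_imp_zero: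
  fixes A B :: real
  assumes "\<And>c. 0 \<le> c * A + c\<^sup>2 * B"
  shows "A = 0"
proof (rule ccontr)
  assume A: "A \<noteq> 0"
  \<comment> \<open>\<open>C\<close> is positive and exceeds \<open>B\<close> whatever the sign of
    \<open>B\<close>, so the choice \<open>c = - A / C\<close> makes the expression strictly
    negative when \<open>A\<close> is not zero.\<close>
  define C where "C = \<bar>B\<bar> + 1"
  have C: "C > 0" "B < C" by (auto simp: C_def)
  have "0 \<le> (- A / C) * A + (- A / C)\<^sup>2 * B" by (rule assms)
  also have "\<dots> < (- A / C) * A + (- A / C)\<^sup>2 * C"
    using A C by (intro add_strict_left_mono mult_strict_left_mono) auto
  also have "\<dots> = 0"
    using C by (simp add: power2_eq_square)
  finally show False by simp
qed

lemma indicator_time_measurable: "(\<lambda>s. indicator {0..t} s :: real) \<in> borel_measurable (time_measure u)"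
  by (intro measurable_restrict_space1) simp

lemma sq_process_indicator_mult:
  assumes "sq_process f"
  shows "sq_process (\<lambda>s \<omega>. indicator {0..t} s * f s \<omega>)"
proof (rule sq_integrable_bounded_mult[OF assms])
  show "(\<lambda>p. indicator {0..t} (fst p) :: real) \<in> borel_measurable Q"
    using indicator_time_measurable by measurable
qed (auto simp: indicator_def)

lemma sq_process_const: "sq_process (\<lambda>_ _. c)"
  by (rule Q.sq_integrable_const)

text \<open>
  Perturbing the equilibrium control by \<open>c 1\<^bsub>[0,t]\<^esub>\<close>: since \<open>m\<close> is the mean of the state, the
  first-order condition reduces to \<open>E \<integral>\<^sub>0\<^sup>t \<alpha> ds = 0\<close>.
\<close>

lemma NE_mean:
  assumes NE: "mean_field_NE M W \<xi> T a b \<epsilon> \<alpha> m" and t: "t \<in> {0..T}"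
  shows "m t = expectation \<xi>"
proof -
  have \<alpha>: "\<alpha> \<in> H2 M T F\<^sub>1" and m: "continuous_on {0..T} m"
    and opt: "\<And>\<beta>. \<beta> \<in> H2 M T F\<^sub>1 \<Longrightarrow>
      payoff M W \<xi> T a b \<epsilon> \<beta> (\<lambda>t _. m t) \<le> payoff M W \<xi> T a b \<epsilon> \<alpha> (\<lambda>t _. m t)"
    and mean: "\<And>t. t \<in> {0..T} \<Longrightarrow> m t = expectation (state W \<xi> \<alpha> t)"
    using NE by (auto simp: mean_field_NE_def)
  note \<alpha>_sq = H2_F1_D(2)[OF \<alpha>] and m_sq = sq_process_fst[OF m]
  define X where "X = state W \<xi> \<alpha>"
  have X_sq: "sq_process X" unfolding X_def by (rule state_sq_process[OF \<alpha>_sq])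
  \<comment> \<open>A deterministic direction, hence progressive for the small filtration; the
    factor \<open>1\<close> exhibits it as an indicator times a constant process.\<close>
  define f where "f = (\<lambda>s (\<omega>::'a). indicator {0..t} s * 1 :: real)"
  define G where "G s = (LBINT u:{0..s}. indicator {0..t} u * 1 :: real)" for s
  have f_sq: "sq_process f"
    unfolding f_def by (rule sq_process_indicator_mult[OF sq_process_const])
  have G_sq: "sq_process (\<lambda>s _. G s)"
    using sq_process_primitive[OF f_sq] by (simp add: f_def G_def)
  \<comment> \<open>Perturbing by \<open>c * f\<close> lowers the payoff by exactly
    \<open>c * A + c\<^sup>2 * B\<close>; optimality makes this nonnegative for both signs of
    \<open>c\<close>.\<close>
  define A where "A = (\<integral>p. \<alpha> (fst p) (snd p) * f (fst p) (snd p)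
      + \<epsilon> * ((X (fst p) (snd p) - m (fst p)) * G (fst p)) \<partial>Q)"
  define B where "B = (\<integral>p. 1 / 2 * (f (fst p) (snd p))\<^sup>2 + \<epsilon> / 2 * (G (fst p))\<^sup>2 \<partial>Q)"
  have "0 \<le> c * A + c\<^sup>2 * B" for c
  proof -
    define \<delta> where "\<delta> = (\<lambda>s \<omega>. c * f s \<omega>)"
    have \<delta>_sq: "sq_process \<delta>" unfolding \<delta>_def by (rule sq_integrable_cmult[OF f_sq])
    have D: "(LBINT u:{0..s}. \<delta> u \<omega>) = c * G s" for s \<omega>
      unfolding \<delta>_def G_def f_def by simp
    have prog: "progressively_measurable T F\<^sub>1 (\<lambda>s \<omega>. \<alpha> s \<omega> + \<delta> s \<omega>)"
      unfolding progressively_measurable_def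
    proof
      fix u assume u: "u \<in> {0..T}"
      note [measurable] = progressive_measurable[OF H2_F1_D(1)[OF \<alpha>] u] indicator_time_measurable
      have "(\<lambda>p. \<alpha> (fst p) (snd p) + \<delta> (fst p) (snd p)) \<in> borel_measurable (time_measure u \<Otimes>\<^sub>M F\<^sub>1 u)"
        unfolding \<delta>_def f_def by measurable
      then show "(\<lambda>(s, \<omega>). \<alpha> s \<omega> + \<delta> s \<omega>) \<in> borel_measurable (restrict_space borel {0..u} \<Otimes>\<^sub>M F\<^sub>1 u)"
        by (simp add: measurable_time_pair case_prod_beta')
    qed
    have "(\<lambda>s \<omega>. \<alpha> s \<omega> + \<delta> s \<omega>) \<in> H2 M T F\<^sub>1"
      using H2_iff[of F\<^sub>1] F1_subalgebra_M[of T] T_pos prog sq_integrable_add[OF \<alpha>_sq \<delta>_sq] by simp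
    from opt[OF this] have "0 \<le> (\<integral>p. \<alpha> (fst p) (snd p) * \<delta> (fst p) (snd p)
          + \<epsilon> * ((X (fst p) (snd p) - m (fst p)) * (c * G (fst p))) \<partial>Q)
        + (\<integral>p. 1 / 2 * (\<delta> (fst p) (snd p))\<^sup>2 + \<epsilon> / 2 * (c * G (fst p))\<^sup>2 \<partial>Q)"
      unfolding payoff_perturb[OF \<alpha>_sq \<delta>_sq m_sq] X_def D by simp
    also have "(\<integral>p. \<alpha> (fst p) (snd p) * \<delta> (fst p) (snd p)
          + \<epsilon> * ((X (fst p) (snd p) - m (fst p)) * (c * G (fst p))) \<partial>Q) = c * A"
      unfolding A_def integral_mult_right_zero[symmetric]
      by (intro Bochner_Integration.integral_cong) (simp_all add: \<delta>_def algebra_simps)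
    also have "(\<integral>p. 1 / 2 * (\<delta> (fst p) (snd p))\<^sup>2 + \<epsilon> / 2 * (c * G (fst p))\<^sup>2 \<partial>Q) = c\<^sup>2 * B"
      unfolding B_def integral_mult_right_zero[symmetric]
      by (intro Bochner_Integration.integral_cong) (simp_all add: \<delta>_def power_mult_distrib algebra_simps)
    finally show ?thesis .
  qed
  then have "A = 0" by (rule linear_le_quadratic_imp_zero)
  have int1: "integrable Q (\<lambda>p. \<alpha> (fst p) (snd p) * f (fst p) (snd p))"
    by (rule sq_integrable_mult_integrable[OF \<alpha>_sq f_sq])
  have int2: "integrable Q (\<lambda>p. (X (fst p) (snd p) - m (fst p)) * G (fst p))"
    by (intro sq_integrable_mult_integrable sq_integrable_diff X_sq m_sq G_sq)
  \<comment> \<open>The tracking term vanishes because \<open>G\<close> is deterministic and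
    \<open>m\<close> is the mean of the state.\<close>
  have "(\<integral>p. (X (fst p) (snd p) - m (fst p)) * G (fst p) \<partial>Q)
      = (\<integral>s. expectation (\<lambda>\<omega>. (X s \<omega> - m s) * G s) \<partial>time_measure T)"
    by (rule integral_Q_time[OF int2])
  also have "\<dots> = (\<integral>s. 0 \<partial>time_measure T)"
  proof (rule integral_cong_AE)
    show "AE s in time_measure T. expectation (\<lambda>\<omega>. (X s \<omega> - m s) * G s) = 0"
      using AE_space sq_process_section_time[OF X_sq]
    proof eventually_elim
      case (elim s)
      then show ?case
        using mean[of s] sq_integrable_integrable[OF elim(2)] by (simp add: X_def prob_space)
    qed
  qed (use integrable_time[OF int2] in auto)
  finally have "(\<integral>p. (X (fst p) (snd p) - m (fst p)) * G (fst p) \<partial>Q) = 0" by simp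
  with \<open>A = 0\<close> have "(\<integral>p. \<alpha> (fst p) (snd p) * f (fst p) (snd p) \<partial>Q) = 0"
    unfolding A_def using int1 int2 by simp
  moreover have D: "(\<integral>s. \<alpha> s \<omega> * f s \<omega> \<partial>time_measure T) = (LBINT s:{0..t}. \<alpha> s \<omega>)" for \<omega>
    using t by (simp add: set_integral_time[of t T] f_def mult.commute)
  ultimately have "expectation (\<lambda>\<omega>. LBINT s:{0..t}. \<alpha> s \<omega>) = 0"
    using integral_Q_sample[OF int1] by simp
  moreover have "integrable M (\<lambda>\<omega>. LBINT s:{0..t}. \<alpha> s \<omega>)"
    using integrable_sample[OF int1] by (simp add: D)
  ultimately show ?thesis
    unfolding mean[OF t] state_def
    using sq_integrable_integrable[OF xi_sq] sq_integrable_integrable[OF W_sq[OF t]] W_moments[OF t]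
    by simp
qed

text \<open>Along \<open>\<delta> = \<alpha> - \<gamma>\<close> the linear term of the expansion
  vanishes, since the state of \<open>\<gamma>\<close> deviates from the mean by \<open>Y\<close>,
  and the quadratic term can only lower the payoff.\<close>

lemma gamma_optimal:
  assumes \<alpha>: "\<alpha> \<in> H2 M T F\<^sub>1"
  shows "payoff M W \<xi> T a b \<epsilon> \<alpha> (\<lambda>_ _. expectation \<xi>) \<le> payoff M W \<xi> T a b \<epsilon> \<gamma> (\<lambda>_ _. expectation \<xi>)"
proof -
  define \<delta> where "\<delta> = (\<lambda>t \<omega>. \<alpha> t \<omega> - \<gamma> t \<omega>)"
  define D where "D = (\<lambda>t \<omega>. LBINT s:{0..t}. \<delta> s \<omega>)"
  have \<delta>_sq: "sq_process \<delta>"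
    unfolding \<delta>_def by (intro sq_integrable_diff H2_F1_D \<alpha> gamma_sq_process)
  have "progressively_measurable T F\<^sub>1 \<delta>"
    unfolding progressively_measurable_def
  proof
    fix u assume u: "u \<in> {0..T}"
    note [measurable] = progressive_measurable[OF H2_F1_D(1)[OF \<alpha>] u] progressive_measurable[OF gamma_progressive u]
    have "(\<lambda>p. \<delta> (fst p) (snd p)) \<in> borel_measurable (time_measure u \<Otimes>\<^sub>M F\<^sub>1 u)"
      unfolding \<delta>_def by measurable
    then show "(\<lambda>(s, \<omega>). \<delta> s \<omega>) \<in> borel_measurable (restrict_space borel {0..u} \<Otimes>\<^sub>M F\<^sub>1 u)"
      by (simp add: measurable_time_pair case_prod_beta')
  qed
  then have \<delta>: "\<delta> \<in> H2 M T F"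
    using H2_iff[of F\<^sub>1] F1_subalgebra_M[of T] T_pos \<delta>_sq H2_F1_subset by auto
  have "(\<integral>p. \<gamma> (fst p) (snd p) * \<delta> (fst p) (snd p)
          + \<epsilon> * ((state W \<xi> \<gamma> (fst p) (snd p) - expectation \<xi>) * D (fst p) (snd p)) \<partial>Q)
      = (\<integral>p. \<gamma> (fst p) (snd p) * \<delta> (fst p) (snd p) + \<epsilon> * (Y (fst p) (snd p) * D (fst p) (snd p)) \<partial>Q)"
    by (intro Bochner_Integration.integral_cong) (auto simp: space_pair_measure state_gamma[simplified])
  also have "\<dots> = 0"
    unfolding D_def by (rule first_order_condition[OF \<delta>])
  finally have foc: "(\<integral>p. \<gamma> (fst p) (snd p) * \<delta> (fst p) (snd p)
          + \<epsilon> * ((state W \<xi> \<gamma> (fst p) (snd p) - expectation \<xi>) * D (fst p) (snd p)) \<partial>Q) = 0" .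
  have "0 \<le> (\<integral>p. 1 / 2 * (\<delta> (fst p) (snd p))\<^sup>2 + \<epsilon> / 2 * (D (fst p) (snd p))\<^sup>2 \<partial>Q)"
    using eps_pos by simp
  moreover have "\<alpha> = (\<lambda>t \<omega>. \<gamma> t \<omega> + \<delta> t \<omega>)"
    by (simp add: \<delta>_def)
  ultimately show ?thesis
    using payoff_perturb[OF gamma_sq_process \<delta>_sq sq_process_const[of "expectation \<xi>"]] foc
    unfolding D_def by simp
qed

text \<open>Both controls are optimal against the same constant flow, so their values agree by two
  opposite inequalities; the controls themselves are never compared.\<close>

lemma NE_payoff:
  assumes NE: "mean_field_NE M W \<xi> T a b \<epsilon> \<alpha> m"
  shows "payoff M W \<xi> T a b \<epsilon> \<alpha> (\<lambda>t _. m t) = payoff M W \<xi> T a b \<epsilon> \<gamma> (\<lambda>_ _. expectation \<xi>)"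
proof -
  have \<alpha>: "\<alpha> \<in> H2 M T F\<^sub>1"
    and opt: "payoff M W \<xi> T a b \<epsilon> \<gamma> (\<lambda>t _. m t) \<le> payoff M W \<xi> T a b \<epsilon> \<alpha> (\<lambda>t _. m t)"
    using NE gamma_H2 by (auto simp: mean_field_NE_def)
  have "payoff M W \<xi> T a b \<epsilon> \<beta> (\<lambda>t _. m t) = payoff M W \<xi> T a b \<epsilon> \<beta> (\<lambda>_ _. expectation \<xi>)" for \<beta>
    by (rule payoff_cong[OF NE_mean[OF NE]])
  with opt gamma_optimal[OF \<alpha>] show ?thesis by simp
qed

section \<open>Correlated flows of class \<open>\<G>\<^sub>l\<close>\<close>

text \<open>\<open>Y\<close> is built from \<open>\<xi>\<close> minus its mean, which is independent
  of \<open>Z\<close>, and from values of \<open>W\<close>, which are orthogonal to every square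
  integrable variable known at time \<open>0\<close>. \<open>Z\<close> itself need not be
  centred.\<close>

lemma Y_orthogonal:
  assumes Z: "Z \<in> borel_measurable (F 0)" "sq_integrable M Z" "indep_of_data M T W \<xi> borel Z"
    and t: "t \<in> {0..T}"
  shows "integrable M (\<lambda>\<omega>. Y t \<omega> * Z \<omega>)" "expectation (\<lambda>\<omega>. Y t \<omega> * Z \<omega>) = 0"
proof -
  \<comment> \<open>The kernel extended by zero beyond \<open>t\<close>, so that the expectation of
    its primitive times \<open>Z\<close> can be taken under the time integral.\<close>
  define k where "k = (\<lambda>s \<omega>. indicator {0..t} s * ((\<phi> s * exp (\<Phi> s)) * W s \<omega>))"
  have k: "sq_process k"
    unfolding k_def
    by (intro sq_process_indicator_mult sq_process_cont_mult W_sq_process continuous_intros phi_cont Phi_cont)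
  have int: "integrable Q (\<lambda>p. k (fst p) (snd p) * Z (snd p))"
    by (intro sq_integrable_mult_integrable k sq_integrable_Q_snd Z)
  have K: "(\<integral>s. k s \<omega> * Z \<omega> \<partial>time_measure T) = (LBINT s:{0..t}. (\<phi> s * exp (\<Phi> s)) * W s \<omega>) * Z \<omega>" for \<omega>
    using t by (simp add: k_def set_integral_time[of t T])
  have "expectation (\<lambda>\<omega>. \<integral>s. k s \<omega> * Z \<omega> \<partial>time_measure T) =
      (\<integral>s. expectation (\<lambda>\<omega>. k s \<omega> * Z \<omega>) \<partial>time_measure T)"
    using integral_Q_sample[OF int] integral_Q_time[OF int] by simp
  also have "\<dots> = (\<integral>s. 0 \<partial>time_measure T)"
  proof (intro Bochner_Integration.integral_cong refl)
    fix s assume "s \<in> space (time_measure T)"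
    then show "expectation (\<lambda>\<omega>. k s \<omega> * Z \<omega>) = 0"
      using W_orthogonal_F0[OF _ Z(1,2), of s] by (simp add: k_def mult.assoc)
  qed
  finally have K0: "expectation (\<lambda>\<omega>. (LBINT s:{0..t}. (\<phi> s * exp (\<Phi> s)) * W s \<omega>) * Z \<omega>) = 0"
    by (simp only: K Bochner_Integration.integral_zero)
  have K_int: "integrable M (\<lambda>\<omega>. (LBINT s:{0..t}. (\<phi> s * exp (\<Phi> s)) * W s \<omega>) * Z \<omega>)"
    using integrable_sample[OF int] by (simp only: K)
  have xi_int: "integrable M (\<lambda>\<omega>. Z \<omega> * \<xi> \<omega>)" and W_int: "integrable M (\<lambda>\<omega>. W t \<omega> * Z \<omega>)"
    and Z_int: "integrable M Z"
    by (intro sq_integrable_mult_integrable Z xi_sq W_sq t sq_integrable_integrable)+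
  have eq: "Y t \<omega> * Z \<omega> = exp (- \<Phi> t) * (Z \<omega> * \<xi> \<omega> - expectation \<xi> * Z \<omega>
      - (LBINT s:{0..t}. (\<phi> s * exp (\<Phi> s)) * W s \<omega>) * Z \<omega>) + W t \<omega> * Z \<omega>" for \<omega>
    unfolding Y_def R_def by (simp add: algebra_simps)
  show "integrable M (\<lambda>\<omega>. Y t \<omega> * Z \<omega>)"
    unfolding eq using K_int xi_int W_int Z_int
    by (intro Bochner_Integration.integrable_add Bochner_Integration.integrable_diff integrable_mult_right)
  have i1: "integrable M (\<lambda>\<omega>. Z \<omega> * \<xi> \<omega> - expectation \<xi> * Z \<omega>
      - (LBINT s:{0..t}. (\<phi> s * exp (\<Phi> s)) * W s \<omega>) * Z \<omega>)"
    using K_int xi_int Z_int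
    by (intro Bochner_Integration.integrable_add Bochner_Integration.integrable_diff integrable_mult_right)
  have "expectation (\<lambda>\<omega>. Z \<omega> * \<xi> \<omega> - expectation \<xi> * Z \<omega>
      - (LBINT s:{0..t}. (\<phi> s * exp (\<Phi> s)) * W s \<omega>) * Z \<omega>) = 0"
    using K_int xi_int Z_int K0 indep_of_data_expectation[OF Z(3,2)] by simp
  then show "expectation (\<lambda>\<omega>. Y t \<omega> * Z \<omega>) = 0"
    unfolding eq using i1 W_int W_orthogonal_F0[OF t Z(1,2)] by simp
qed

text \<open>The feedback relation defines \<open>\<Lambda>\<close> only through its own state, so
  the state is identified by uniqueness: its deviation from \<open>\<mu> + Y\<close> solves the
  homogeneous linear equation started at zero.\<close>

lemma G_l_path:
  assumes G: "in_G_l M F W \<xi> T \<phi> \<Lambda> \<mu> Z"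
  shows "AE \<omega> in M. \<forall>t\<in>{0..T}. \<mu> t \<omega> = expectation \<xi> + t * Z \<omega> \<and> \<Lambda> t \<omega> = \<gamma> t \<omega> + Z \<omega>
      \<and> state W \<xi> \<Lambda> t \<omega> = \<mu> t \<omega> + Y t \<omega>"
proof -
  have \<Lambda>_sq: "sq_process \<Lambda>"
    using G H2_sq_process by (simp add: in_G_l_def correlated_flow_def)
  have ae: "AE \<omega> in M. \<forall>t\<in>{0..T}. \<mu> t \<omega> = expectation \<xi> + t * Z \<omega>"
    "AE \<omega> in M. \<forall>t\<in>{0..T}. \<Lambda> t \<omega> = \<phi> t * (\<mu> t \<omega> - state W \<xi> \<Lambda> t \<omega>) + Z \<omega>"
    using G by (simp_all add: in_G_l_def)
  show ?thesis
    using AE_space ae sq_process_section_sample[OF \<Lambda>_sq]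
  proof eventually_elim
    case (elim \<omega>)
    note \<omega> = elim(1) and \<mu>_eq = elim(2) and \<Lambda>_eq = elim(3)
    define E where "E t = state W \<xi> \<Lambda> t \<omega> - \<mu> t \<omega> - Y t \<omega>" for t
    have \<gamma>_cont: "continuous_on {0..T} (\<lambda>s. Z \<omega> + \<gamma> s \<omega>)"
      by (intro continuous_intros phi_cont Y_cont \<omega>)
    have int: "integrable (time_measure T) (\<lambda>s. \<Lambda> s \<omega> - (Z \<omega> + \<gamma> s \<omega>))"
      by (intro Bochner_Integration.integrable_diff L.sq_integrable_integrable elim(4)
        continuous_on_integrable_time \<gamma>_cont)
    have E_eq: "E t = (LBINT s:{0..t}. \<Lambda> s \<omega> - (Z \<omega> + \<gamma> s \<omega>))" if t: "t \<in> {0..T}" for t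
    proof -
      have c: "set_integrable lborel {0..t} g" if "continuous_on {0..T} g" for g :: "real \<Rightarrow> real"
        using set_integrable_time[OF continuous_on_integrable_time[OF that]] t by simp
      have i: "set_integrable lborel {0..t} (\<lambda>s. Z \<omega> + \<gamma> s \<omega>)"
        "set_integrable lborel {0..t} (\<lambda>s. \<gamma> s \<omega>)" "set_integrable lborel {0..t} (\<lambda>s. Z \<omega>)"
        by (rule c, intro continuous_intros phi_cont Y_cont \<omega>)+
      have "set_integrable lborel {0..t} (\<lambda>s. \<Lambda> s \<omega>)"
        using set_integrable_time[OF L.sq_integrable_integrable[OF elim(4)]] t by simp
      note diff = set_integral_diff(2)[OF this i(1)]
      have "(LBINT s:{0..t}. Z \<omega>) = t * Z \<omega>"
        using t by (simp add: set_lebesgue_integral_def)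
      then have "(LBINT s:{0..t}. Z \<omega> + \<gamma> s \<omega>) = t * Z \<omega> + (R t \<omega> - R 0 \<omega>)"
        by (simp only: set_integral_add(2)[OF i(3,2)] R_eq[OF \<omega> t])
      then have rhs: "(LBINT s:{0..t}. \<Lambda> s \<omega> - (Z \<omega> + \<gamma> s \<omega>))
          = (LBINT s:{0..t}. \<Lambda> s \<omega>) - (t * Z \<omega> + (R t \<omega> - R 0 \<omega>))"
        by (simp only: diff)
      have lhs: "E t = \<xi> \<omega> + (LBINT s:{0..t}. \<Lambda> s \<omega>) + W t \<omega> - \<mu> t \<omega> - (R t \<omega> + W t \<omega>)"
        by (simp only: E_def state_def Y_def)
      have \<mu>: "\<mu> t \<omega> = expectation \<xi> + t * Z \<omega>"
        using \<mu>_eq t by blast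
      show ?thesis
        unfolding lhs rhs \<mu> R_0 by algebra
    qed
    \<comment> \<open>Continuity has to come from the primitive, since the path of
      \<open>\<Lambda>\<close> is so far known only to be square integrable in time.\<close>
    have E_cont: "continuous_on {0..T} E"
      using primitive_continuous[OF int] by (rule continuous_on_eq) (rule E_eq[symmetric])
    have "E t = (LBINT s:{0..t}. - \<phi> s * E s)" if t: "t \<in> {0..T}" for t
      unfolding E_eq[OF t]
    proof (rule set_lebesgue_integral_cong)
      show "\<forall>s. s \<in> {0..t} \<longrightarrow> \<Lambda> s \<omega> - (Z \<omega> + \<gamma> s \<omega>) = - \<phi> s * E s"
        using \<Lambda>_eq t by (auto simp: E_def algebra_simps)
    qed simp
    then have E0: "E t = 0" if "t \<in> {0..T}" for t
      by (rule linear_ode_unique[OF E_cont _ that])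
    show ?case
    proof
      fix t assume t: "t \<in> {0..T}"
      have "state W \<xi> \<Lambda> t \<omega> = \<mu> t \<omega> + Y t \<omega>"
        using E0[OF t] by (simp add: E_def)
      then show "\<mu> t \<omega> = expectation \<xi> + t * Z \<omega> \<and> \<Lambda> t \<omega> = \<gamma> t \<omega> + Z \<omega>
          \<and> state W \<xi> \<Lambda> t \<omega> = \<mu> t \<omega> + Y t \<omega>"
        using \<mu>_eq \<Lambda>_eq t by simp
    qed
  qed
qed

lemma G_l_sq_integrable:
  assumes "in_G_l M F W \<xi> T \<phi> \<Lambda> \<mu> Z"
  shows "sq_integrable M Z"
proof -
  have Z: "Z \<in> borel_measurable (F 0)" "integrable M (\<lambda>\<omega>. (Z \<omega>)\<^sup>2)"
    using assms unfolding in_G_l_def by blast+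
  have "Z \<in> borel_measurable M"
    by (rule F_measurable[OF Z(1)]) (use T_pos in simp)
  with Z(2) show ?thesis by (simp add: sq_integrable_def)
qed

text \<open>Both tracking errors equal \<open>Y\<close> up to sign, so the \<open>\<epsilon>\<close>
  terms cancel. The only remaining term that mixes \<open>Z\<close> with the noise is
  \<open>\<gamma> t \<omega> * Z \<omega>\<close>, and it has mean zero.\<close>

lemma G_l_payoff:
  assumes G: "in_G_l M F W \<xi> T \<phi> \<Lambda> \<mu> Z"
  shows "payoff M W \<xi> T a b \<epsilon> \<Lambda> \<mu> - payoff M W \<xi> T a b \<epsilon> \<gamma> (\<lambda>_ _. expectation \<xi>)
    = T / 2 * (T * expectation Z * (a - b * expectation \<xi>)
        - expectation (\<lambda>\<omega>. (Z \<omega>)\<^sup>2) * (b * T\<^sup>2 / 3 + 1))"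
proof -
  define \<nu> where "\<nu> = expectation \<xi>"
  define z e where "z = expectation Z" and "e = expectation (\<lambda>\<omega>. (Z \<omega>)\<^sup>2)"
  have \<Lambda>_sq: "sq_process \<Lambda>"
    using G H2_sq_process by (simp add: in_G_l_def correlated_flow_def)
  note G' = G[unfolded in_G_l_def correlated_flow_def]
  have Z0: "Z \<in> borel_measurable (F 0)"
    and Z_indep: "indep_of_data M T W \<xi> borel Z"
    and flow: "trajectory T \<mu> \<in> measurable (F 0) (trajectory_space T)"
    and \<mu>_cont: "\<And>\<omega>. \<omega> \<in> space M \<Longrightarrow> continuous_on {0..T} (\<lambda>t. \<mu> t \<omega>)"
    using G' by blast+
  note Z = Z0 G_l_sq_integrable[OF G] Z_indep
  have Z_sq: "sq_process (\<lambda>_. Z)" by (rule sq_integrable_Q_snd[OF Z(2)])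
  note path = AE_Q[OF G_l_path[OF G]]
  \<comment> \<open>An explicit square integrable version of the flow. \<open>\<mu>\<close> agrees
    with it only almost everywhere and obtains joint measurability from the continuity of its own
    paths.\<close>
  define \<eta> where "\<eta> = (\<lambda>t \<omega>. \<nu> + t * Z \<omega>)"
  have \<eta>_sq: "sq_process \<eta>"
    unfolding \<eta>_def
    by (rule sq_integrable_add[OF sq_process_const sq_process_cont_mult[OF Z_sq continuous_on_id]])
  have "(\<lambda>p. \<mu> (fst p) (snd p)) \<in> borel_measurable Q"
  proof (rule continuous_process_measurable[OF _ \<mu>_cont])
    fix s assume s: "s \<in> {0..T}"
    have "(\<lambda>\<omega>. trajectory T \<mu> \<omega> s) \<in> borel_measurable (F 0)"
      using measurable_compose[OF flow measurable_component_singleton[OF s]] by simp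
    then have "\<mu> s \<in> borel_measurable (F 0)"
      using s by (simp add: trajectory_def)
    then show "\<mu> s \<in> borel_measurable M"
      by (rule F_measurable) (use T_pos in simp)
  qed
  moreover have "AE p in Q. \<mu> (fst p) (snd p) = \<eta> (fst p) (snd p)"
    using path by eventually_elim (simp add: \<eta>_def \<nu>_def)
  ultimately have \<mu>_sq: "sq_process \<mu>"
    by (rule sq_integrable_cong_AE[OF \<eta>_sq])
  define u where "u = (\<lambda>t \<omega>. a * \<nu> - b / 2 * \<nu>\<^sup>2 - 1 / 2 * (\<gamma> t \<omega>)\<^sup>2 - \<epsilon> / 2 * (Y t \<omega>)\<^sup>2)"
  \<comment> \<open>\<open>v\<close> is the running payoff of the correlated flow minus
    \<open>u\<close>, the running payoff of the equilibrium: insert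
    \<open>\<nu> + t * Z \<omega>\<close> for the flow and
    \<open>\<gamma> t \<omega> + Z \<omega>\<close> for the control.\<close>
  define v where "v = (\<lambda>t \<omega>. ((a - b * \<nu>) * t) * Z \<omega> - b / 2 * (t * Z \<omega>)\<^sup>2 - 1 / 2 * (Z \<omega>)\<^sup>2 - \<gamma> t \<omega> * Z \<omega>)"
  have u: "integrable Q (\<lambda>p. u (fst p) (snd p))"
    unfolding u_def
    by (intro Bochner_Integration.integrable_diff integrable_mult_right sq_integrable_power2
      gamma_sq_process Y_sq_process Q.integrable_const)
  have v: "integrable Q (\<lambda>p. v (fst p) (snd p))"
    unfolding v_def
    by (intro Bochner_Integration.integrable_diff integrable_mult_right sq_integrable_power2
      sq_integrable_mult_integrable gamma_sq_process Z_sq sq_process_cont_mult sq_process_fst continuous_intros)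
  have "payoff M W \<xi> T a b \<epsilon> \<gamma> (\<lambda>_ _. \<nu>) = (\<integral>p. u (fst p) (snd p) \<partial>Q)"
    unfolding payoff_eq[OF gamma_sq_process sq_process_const] u_def
    by (intro Bochner_Integration.integral_cong) (auto simp: space_pair_measure state_gamma[simplified] \<nu>_def)
  moreover have "payoff M W \<xi> T a b \<epsilon> \<Lambda> \<mu> = (\<integral>p. u (fst p) (snd p) + v (fst p) (snd p) \<partial>Q)"
    unfolding payoff_eq[OF \<Lambda>_sq \<mu>_sq]
  proof (rule integral_cong_AE)
    show "(\<lambda>p. a * \<mu> (fst p) (snd p) - b / 2 * (\<mu> (fst p) (snd p))\<^sup>2 - 1 / 2 * (\<Lambda> (fst p) (snd p))\<^sup>2
        - \<epsilon> / 2 * (\<mu> (fst p) (snd p) - state W \<xi> \<Lambda> (fst p) (snd p))\<^sup>2) \<in> borel_measurable Q"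
      by (intro borel_measurable_integrable running_payoff_integrable \<mu>_sq \<Lambda>_sq state_sq_process
        Q.sq_integrable_integrable)
    show "AE p in Q. a * \<mu> (fst p) (snd p) - b / 2 * (\<mu> (fst p) (snd p))\<^sup>2 - 1 / 2 * (\<Lambda> (fst p) (snd p))\<^sup>2
        - \<epsilon> / 2 * (\<mu> (fst p) (snd p) - state W \<xi> \<Lambda> (fst p) (snd p))\<^sup>2 = u (fst p) (snd p) + v (fst p) (snd p)"
      using path
    proof eventually_elim
      case (elim p)
      define y where "y = \<gamma> (fst p) (snd p)"
      have L: "\<Lambda> (fst p) (snd p) = y + Z (snd p)" and X: "state W \<xi> \<Lambda> (fst p) (snd p) = \<mu> (fst p) (snd p) + Y (fst p) (snd p)"
        and \<mu>: "\<mu> (fst p) (snd p) = \<nu> + fst p * Z (snd p)"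
        using elim by (simp_all add: y_def \<nu>_def)
      show ?case
        unfolding L X \<mu> u_def v_def y_def[symmetric] by (simp add: power2_eq_square field_simps)
    qed
  qed (use u v in auto)
  moreover have "(\<integral>p. u (fst p) (snd p) + v (fst p) (snd p) \<partial>Q)
      = (\<integral>p. u (fst p) (snd p) \<partial>Q) + (\<integral>p. v (fst p) (snd p) \<partial>Q)"
    by (rule Bochner_Integration.integral_add[OF u v])
  moreover have "(\<integral>p. v (fst p) (snd p) \<partial>Q) = T / 2 * (T * z * (a - b * \<nu>) - e * (b * T\<^sup>2 / 3 + 1))"
  proof -
    have "(\<integral>p. v (fst p) (snd p) \<partial>Q) = (\<integral>t. expectation (v t) \<partial>time_measure T)"
      by (rule integral_Q_time[OF v])
    also have "\<dots> = (\<integral>t. (a - b * \<nu>) * t * z - b / 2 * t\<^sup>2 * e - 1 / 2 * e \<partial>time_measure T)"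
    proof (intro Bochner_Integration.integral_cong refl)
      fix t assume "t \<in> space (time_measure T)"
      then have t: "t \<in> {0..T}" by simp
      have v_eq: "v t = (\<lambda>\<omega>. ((a - b * \<nu>) * t) * Z \<omega> - (b / 2 * t\<^sup>2) * (Z \<omega>)\<^sup>2 - 1 / 2 * (Z \<omega>)\<^sup>2
          + \<phi> t * (Y t \<omega> * Z \<omega>))"
        by (auto simp: v_def power_mult_distrib)
      have i: "integrable M (\<lambda>\<omega>. ((a - b * \<nu>) * t) * Z \<omega>)" "integrable M (\<lambda>\<omega>. (b / 2 * t\<^sup>2) * (Z \<omega>)\<^sup>2)"
        "integrable M (\<lambda>\<omega>. 1 / 2 * (Z \<omega>)\<^sup>2)" "integrable M (\<lambda>\<omega>. \<phi> t * (Y t \<omega> * Z \<omega>))"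
        by (intro integrable_mult_right sq_integrable_integrable sq_integrable_power2 Y_orthogonal Z t)+
      have "expectation (v t) = ((a - b * \<nu>) * t) * z - (b / 2 * t\<^sup>2) * e - 1 / 2 * e
          + \<phi> t * expectation (\<lambda>\<omega>. Y t \<omega> * Z \<omega>)"
        unfolding v_eq z_def e_def integral_mult_right_zero[symmetric]
        by (simp only: i Bochner_Integration.integral_add Bochner_Integration.integral_diff
          Bochner_Integration.integrable_diff)
      then show "expectation (v t) = (a - b * \<nu>) * t * z - b / 2 * t\<^sup>2 * e - 1 / 2 * e"
        using Y_orthogonal(2)[OF Z t] by simp
    qed
    also have "\<dots> = (LBINT t:{0..T}. (a - b * \<nu>) * t * z - b / 2 * t\<^sup>2 * e - 1 / 2 * e)"
      by (rule set_integral_time_full[symmetric])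
    \<comment> \<open>The antiderivative of the quadratic in \<open>t\<close>, taken between
      \<open>0\<close> and \<open>T\<close>. Factoring out \<open>T / 2\<close> turns the cubic
      coefficient \<open>b * e / 6\<close> into \<open>b * T\<^sup>2 / 3\<close>.\<close>
    also have "\<dots> = ((a - b * \<nu>) * z / 2 * T\<^sup>2 - b * e / 6 * T ^ 3 - e / 2 * T)
        - ((a - b * \<nu>) * z / 2 * 0\<^sup>2 - b * e / 6 * 0 ^ 3 - e / 2 * 0)"
    proof (rule set_integral_derivative)
      fix s :: real
      have "((\<lambda>t. (a - b * \<nu>) * z / 2 * t\<^sup>2 - b * e / 6 * t ^ 3 - e / 2 * t) has_real_derivative
          (a - b * \<nu>) * z / 2 * (2 * s) - b * e / 6 * (3 * s\<^sup>2) - e / 2 * 1) (at s within {0..T})"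
        using DERIV_pow[of 2 s "{0..T}"] DERIV_pow[of 3 s "{0..T}"]
        by (intro DERIV_diff DERIV_cmult DERIV_ident) simp_all
      then show "((\<lambda>t. (a - b * \<nu>) * z / 2 * t\<^sup>2 - b * e / 6 * t ^ 3 - e / 2 * t) has_real_derivative
          (a - b * \<nu>) * s * z - b / 2 * s\<^sup>2 * e - 1 / 2 * e) (at s within {0..T})"
        by (rule DERIV_cong) simp
    qed (use T_pos in \<open>auto intro!: continuous_intros\<close>)
    also have "\<dots> = T / 2 * (T * z * (a - b * \<nu>) - e * (b * T\<^sup>2 / 3 + 1))"
      by (simp add: power2_eq_square power3_eq_cube field_simps)
    finally show ?thesis .
  qed
  ultimately show ?thesis
    unfolding \<nu>_def z_def e_def by simp
qed

end

theorem proposition5p5: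
  fixes M :: "'a measure" and F :: "real \<Rightarrow> 'a measure" and W :: "real \<Rightarrow> 'a \<Rightarrow> real"
    and \<xi> :: "'a \<Rightarrow> real" and T a b \<epsilon> :: real and \<phi> :: "real \<Rightarrow> real"
    and \<alpha> \<Lambda> \<mu> :: "real \<Rightarrow> 'a \<Rightarrow> real" and m :: "real \<Rightarrow> real" and Z :: "'a \<Rightarrow> real"
    and \<nu>\<^sub>1 z\<^sub>1 \<sigma>\<^sub>z :: real
  assumes "emission_game M F W \<xi> T a b \<epsilon> \<phi>"
    and "mean_field_NE M W \<xi> T a b \<epsilon> \<alpha> m"
    and "in_G_l M F W \<xi> T \<phi> \<Lambda> \<mu> Z"
    and "\<nu>\<^sub>1 = prob_space.expectation M \<xi>"
    and "z\<^sub>1 = prob_space.expectation M Z"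
    and "\<sigma>\<^sub>z\<^sup>2 = prob_space.variance M Z"
  shows "payoff M W \<xi> T a b \<epsilon> \<Lambda> \<mu> \<ge> payoff M W \<xi> T a b \<epsilon> \<alpha> (\<lambda>t _. m t) \<longleftrightarrow>
         T * z\<^sub>1 * (a - b * \<nu>\<^sub>1) - (z\<^sub>1\<^sup>2 + \<sigma>\<^sub>z\<^sup>2) * (b * T\<^sup>2 / 3 + 1) \<ge> 0"
proof -
  interpret emission_game M F W \<xi> T a b \<epsilon> \<phi> by fact
  note Z = G_l_sq_integrable[OF assms(3)]
  \<comment> \<open>The payoff gap involves the second moment of \<open>Z\<close>; splitting it into
    squared mean and variance gives the stated form.\<close>
  have "\<sigma>\<^sub>z\<^sup>2 = expectation (\<lambda>\<omega>. (Z \<omega>)\<^sup>2) - z\<^sub>1\<^sup>2"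
    unfolding assms(5,6) by (intro variance_eq sq_integrable_integrable sq_integrable_power2 Z)
  then have e: "expectation (\<lambda>\<omega>. (Z \<omega>)\<^sup>2) = z\<^sub>1\<^sup>2 + \<sigma>\<^sub>z\<^sup>2" by simp
  have "payoff M W \<xi> T a b \<epsilon> \<Lambda> \<mu> - payoff M W \<xi> T a b \<epsilon> \<alpha> (\<lambda>t _. m t)
      = T / 2 * (T * z\<^sub>1 * (a - b * \<nu>\<^sub>1) - (z\<^sub>1\<^sup>2 + \<sigma>\<^sub>z\<^sup>2) * (b * T\<^sup>2 / 3 + 1))"
    using G_l_payoff[OF assms(3)] unfolding NE_payoff[OF assms(2)] e assms(4,5) .
  \<comment> \<open>The payoff gap is the stated expression times \<open>T / 2\<close>, and this
    factor is positive, so both have the same sign.\<close>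
  moreover have "0 \<le> T / 2 * c \<longleftrightarrow> 0 \<le> c" for c
    using T_pos by (simp add: zero_le_mult_iff)
  ultimately show ?thesis
    by (metis diff_ge_0_iff_ge)
qed

end
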